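(* Let $\mathcal{C}$ be the set of all bivariate copulas and let $$\Omega_{\phi,\gamma,\tau}=\big\{(\phi(C),\gamma(C),\tau(C))\in[-\tfrac12,1]\times[-1,1]\times[-1,1] \mid C\in\mathcal{C}\big\}$$ be the exact region determined by Spearman's footrule $\phi$, Gini's gamma $\gamma$ and Kendall's tau $\tau$. Then $\Omega_{\phi,\gamma,\tau}=\Omega$, where $\Omega\subset\mathbb{R}^3$ is the polyhedron consisting of all $(\phi,\gamma,\tau)\in\mathbb{R}^3$ satisfying the seven inequalities $$-2\phi\le 1,\quad -8\phi+6\gamma\le 1,\quad -2\phi+3\gamma\le 1,\quad 4\phi-3\tau\le 1,$$ $$-2\phi+3\tau\le 1,\quad -2\phi+3\gamma-3\tau\le 1,\quad 4\phi-6\gamma+3\tau\le 1.$$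
   Context: Let $\mathbb{I}=[0,1]$. A (bivariate) copula is a function $C:\mathbb{I}^2\to\mathbb{I}$ with $C(0,v)=C(u,0)=0$, $C(u,1)=u$, $C(1,v)=v$ for all $u,v\in\mathbb{I}$, and $C(u_2,v_2)-C(u_2,v_1)-C(u_1,v_2)+C(u_1,v_1)\ge 0$ whenever $u_1\le u_2$, $v_1\le v_2$ in $\mathbb{I}$. Each copula induces a Borel probability measure $\mu_C$ on $\mathbb{I}^2$ with $\mu_C([0,u]\times[0,v])=C(u,v)$; integration against it is written $dC(u,v)$. For a copula $C$: Kendall's tau is $\tau(C)=4\int_{\mathbb{I}^2}C(u,v)\,dC(u,v)-1$; Gini's gamma is $\gamma(C)=4\int_0^1 C(u,u)\,du+4\int_0^1 C(u,1-u)\,du-2$; Spearman's footrule is $\phi(C)=6\int_0^1 C(u,u)\,du-2$. *)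

theory Defs
  imports "HOL-Analysis.Analysis" "HOL-Probability.Probability"
begin

text \<open>Copulas are total functions on the reals; only the values on the unit square are
  constrained, and everything below depends only on those values.\<close>

definition copula :: "(real \<Rightarrow> real \<Rightarrow> real) \<Rightarrow> bool" where
  "copula C \<longleftrightarrow>
     (\<forall>u\<in>{0..1}. \<forall>v\<in>{0..1}. C u v \<in> {0..1}) \<and>
     (\<forall>v\<in>{0..1}. C 0 v = 0) \<and> (\<forall>u\<in>{0..1}. C u 0 = 0) \<and>
     (\<forall>u\<in>{0..1}. C u 1 = u) \<and> (\<forall>v\<in>{0..1}. C 1 v = v) \<and>
     (\<forall>u1\<in>{0..1}. \<forall>u2\<in>{0..1}. \<forall>v1\<in>{0..1}. \<forall>v2\<in>{0..1}.
        u1 \<le> u2 \<longrightarrow> v1 \<le> v2 \<longrightarrow> C u2 v2 - C u2 v1 - C u1 v2 + C u1 v1 \<ge> 0)"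

text \<open>For a copula there is exactly one such measure: existence is the Lebesgue-Stieltjes
  construction, and uniqueness holds because the rectangles are an intersection-stable
  generator of the Borel sets of the unit square.\<close>

definition copula_measure :: "(real \<Rightarrow> real \<Rightarrow> real) \<Rightarrow> (real \<times> real) measure" where
  "copula_measure C = (THE M. prob_space M \<and>
     sets M = sets (restrict_space borel ({0..1} \<times> {0..1})) \<and>
     (\<forall>u\<in>{0..1}. \<forall>v\<in>{0..1}. measure M ({0..u} \<times> {0..v}) = C u v))"

definition kendall_tau :: "(real \<Rightarrow> real \<Rightarrow> real) \<Rightarrow> real" where
  "kendall_tau C = 4 * (\<integral>p. C (fst p) (snd p) \<partial>copula_measure C) - 1"

definition gini_gamma :: "(real \<Rightarrow> real \<Rightarrow> real) \<Rightarrow> real" where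
  "gini_gamma C =
     4 * integral {0..1} (\<lambda>u. C u u) + 4 * integral {0..1} (\<lambda>u. C u (1 - u)) - 2"

definition spearman_footrule :: "(real \<Rightarrow> real \<Rightarrow> real) \<Rightarrow> real" where
  "spearman_footrule C = 6 * integral {0..1} (\<lambda>u. C u u) - 2"

text \<open>The region is the plain image of the set of copulas, not intersected with the box
  \<open>[-1/2, 1] \<times> [-1, 1] \<times> [-1, 1]\<close> of admissible values. Since the polyhedron lies in that box
  (lemma \<open>polyhedron_subset_box\<close>), equality of the two sets includes the box bounds.\<close>

definition footrule_gamma_tau_region :: "(real \<times> real \<times> real) set" where
  "footrule_gamma_tau_region =
     {(spearman_footrule C, gini_gamma C, kendall_tau C) | C. copula C}"

definition footrule_gamma_tau_polyhedron :: "(real \<times> real \<times> real) set" where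
  "footrule_gamma_tau_polyhedron = {(\<phi>, \<gamma>, \<tau>).
     - 2 * \<phi> \<le> 1 \<and>
     - 8 * \<phi> + 6 * \<gamma> \<le> 1 \<and>
     - 2 * \<phi> + 3 * \<gamma> \<le> 1 \<and>
     4 * \<phi> - 3 * \<tau> \<le> 1 \<and>
     - 2 * \<phi> + 3 * \<tau> \<le> 1 \<and>
     - 2 * \<phi> + 3 * \<gamma> - 3 * \<tau> \<le> 1 \<and>
     4 * \<phi> - 6 * \<gamma> + 3 * \<tau> \<le> 1}"

lemma polyhedron_subset_box:
  "footrule_gamma_tau_polyhedron \<subseteq> {-1/2..1} \<times> {-1..1} \<times> {-1..1}"
  unfolding footrule_gamma_tau_polyhedron_def by auto

end

theory Submission
  imports Defs
begin

text \<open>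
  Write \<open>A\<close> and \<open>B\<close> for the integrals of \<open>C\<close> over the diagonal and the antidiagonal and \<open>T\<close> for
  the integral of \<open>C\<close> against its own measure. In terms of a random vector \<open>(U, V)\<close> with law \<open>C\<close>
  we have \<open>A = E min(U, V)\<close>, \<open>B = E max(0, U + V - 1)\<close> and \<open>T = E C(U, V)\<close>, and the polyhedron becomes
  \<open>A \<ge> 1/4\<close>, \<open>B \<le> 1/4\<close>, \<open>B \<le> A - 1/8\<close>, \<open>max(2A - 1/2, B) \<le> T \<le> min(A, 2B)\<close>. Each inequality is the
  expectation of a pointwise one; for instance \<open>C(U, V) \<ge> C(U, U) - max(0, U - V)\<close> gives
  \<open>T \<ge> 2A - 1/2\<close>.

  Conversely, fix \<open>A\<close> and \<open>B\<close>. Both are affine in \<open>C\<close>, while \<open>T\<close> is quadratic along a segment of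
  copulas, so by the intermediate value theorem it suffices to reach the two extreme values of \<open>T\<close>.
  The upper one is reached by an explicit interval exchange \<open>V = f(U)\<close>, and the reflection
  \<open>V \<mapsto> 1 - V\<close>, which maps \<open>(A, B, T)\<close> to \<open>(1/2 - B, 1/2 - A, 1/2 - T)\<close>, turns upper
  values into lower ones.
\<close>

subsection \<open>Copulas and their measures\<close>

lemma measure_cdf_unique_plane:
  fixes M N :: "(real \<times> real) measure"
  assumes "prob_space M" "prob_space N" and sets: "sets M = sets borel" "sets N = sets borel"
    and eq: "\<And>a b. emeasure M ({..a} \<times> {..b}) = emeasure N ({..a} \<times> {..b})"
  shows "M = N"
proof (rule measure_eqI_generator_eq[where \<Omega> = UNIV and E = "range (\<lambda>a::real\<times>real. {..a})"
      and A = "\<lambda>i::nat. {..(real i, real i)}"])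
  interpret M: prob_space M by fact
  have atMost_pair: "{..a} = {..fst a} \<times> {..snd a}" for a :: "real \<times> real"
    by (auto simp: less_eq_prod_def)
  show "Int_stable (range (\<lambda>a::real\<times>real. {..a}))"
    unfolding Int_stable_def
  proof (safe)
    fix a b c d :: real
    have "{..(a, b)} \<inter> {..(c, d)} = {..(min a c, min b d)}"
      by (auto simp: less_eq_prod_def)
    then show "{..(a, b)} \<inter> {..(c, d)} \<in> range (\<lambda>a. {..a})"
      by blast
  qed
  have "sets (borel :: (real \<times> real) measure) = sigma_sets UNIV (range (\<lambda>a. {..a}))"
    by (subst borel_eq_atMost) simp
  then show "sets M = sigma_sets UNIV (range (\<lambda>a::real\<times>real. {..a}))"
    "sets N = sigma_sets UNIV (range (\<lambda>a::real\<times>real. {..a}))"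
    using sets by auto
  show "emeasure M X = emeasure N X" if "X \<in> range (\<lambda>a::real\<times>real. {..a})" for X
    using that eq by (auto simp: atMost_pair)
  have "\<exists>i::nat. p \<in> {..(real i, real i)}" for p :: "real \<times> real"
  proof -
    obtain i where "max (fst p) (snd p) \<le> real i"
      using real_arch_simple by blast
    then show ?thesis by (auto simp: less_eq_prod_def intro!: exI[of _ i])
  qed
  then show "(\<Union>i::nat. {..(real i, real i)}) = (UNIV :: (real \<times> real) set)"
    by blast
qed (use assms in \<open>auto simp: prob_space.emeasure_space_1\<close>, simp add: finite_measure.emeasure_finite prob_space.finite_measure)

abbreviation unit_square :: "(real \<times> real) set" where
  "unit_square \<equiv> {0..1} \<times> {0..1}"

abbreviation square_borel :: "(real \<times> real) measure" where
  "square_borel \<equiv> restrict_space borel unit_square"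

lemma unit_square_borel [measurable]: "unit_square \<in> sets borel"
  by (intro borel_closed closed_Times) auto

text \<open>The predicate under \<open>THE\<close> in \<open>copula_measure\<close>, named so that
  existence and uniqueness can be treated separately. Any representing measure may then stand in for
  \<open>copula_measure C\<close>.\<close>

definition represents :: "(real \<times> real) measure \<Rightarrow> (real \<Rightarrow> real \<Rightarrow> real) \<Rightarrow> bool" where
  "represents M C \<longleftrightarrow> prob_space M \<and> sets M = sets square_borel \<and>
     (\<forall>u\<in>{0..1}. \<forall>v\<in>{0..1}. measure M ({0..u} \<times> {0..v}) = C u v)"

lemma rect_in_square_borel:
  assumes "u \<le> 1" "v \<le> 1"
  shows "{0..u} \<times> {0..v} \<in> sets square_borel"
proof -
  have "{0..u} \<times> {0..v} \<in> sets borel"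
    by (intro borel_closed closed_Times) auto
  then show ?thesis using assms
    by (subst sets_restrict_space_iff) auto
qed

text \<open>Both measures are pushed forward to the plane, where quadrants form an
  intersection-stable generator; each quadrant meets the square in a rectangle anchored at the
  origin or in the empty set.\<close>

lemma represents_unique:
  assumes "represents M C" "represents N C"
  shows "M = N"
proof -
  have M: "prob_space M" "sets M = sets square_borel" and N: "prob_space N" "sets N = sets square_borel"
    using assms by (auto simp: represents_def)
  interpret M: prob_space M by fact
  interpret N: prob_space N by fact
  have space: "space M = unit_square" "space N = unit_square"
    using M N by (auto dest!: sets_eq_imp_space_eq simp: space_restrict_space)
  have meas: "(\<lambda>x. x) \<in> measurable M borel" "(\<lambda>x. x) \<in> measurable N borel"
    using M N by (auto intro!: measurable_restrict_space1 cong: measurable_cong_sets)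
  have em: "emeasure (distr M borel (\<lambda>x. x)) X = emeasure M (X \<inter> unit_square)"
     "emeasure (distr N borel (\<lambda>x. x)) X = emeasure N (X \<inter> unit_square)" if "X \<in> sets borel" for X
    using that meas by (auto simp: emeasure_distr space)
  have "distr M borel (\<lambda>x. x) = distr N borel (\<lambda>x. x)"
  proof (rule measure_cdf_unique_plane)
    fix a b :: real
    have b: "{..a} \<times> {..b} \<in> sets borel"
      by (intro borel_closed closed_Times) auto
    have "emeasure M (({..a} \<times> {..b}) \<inter> unit_square) = emeasure N (({..a} \<times> {..b}) \<inter> unit_square)"
    proof (cases "0 \<le> a \<and> 0 \<le> b")
      case True
      then have "({..a} \<times> {..b}) \<inter> unit_square = {0..min a 1} \<times> {0..min b 1}"
        by auto
      moreover have "measure M ({0..min a 1} \<times> {0..min b 1}) = measure N ({0..min a 1} \<times> {0..min b 1})"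
        using assms True unfolding represents_def by simp
      ultimately show ?thesis
        by (simp add: M.emeasure_eq_measure N.emeasure_eq_measure)
    next
      case False
      then have "({..a} \<times> {..b}) \<inter> unit_square = {}"
        by auto
      then show ?thesis by simp
    qed
    then show "emeasure (distr M borel (\<lambda>x. x)) ({..a} \<times> {..b}) = emeasure (distr N borel (\<lambda>x. x)) ({..a} \<times> {..b})"
      using b by (simp add: em)
  qed (use M.prob_space_distr[OF meas(1)] N.prob_space_distr[OF meas(2)] in auto)
  note eq = this
  show ?thesis
  proof (rule measure_eqI)
    fix X assume "X \<in> sets M"
    then have "X \<in> sets borel" "X \<subseteq> unit_square"
      using M by (auto simp: sets_restrict_space_iff)
    then show "emeasure M X = emeasure N X"
      using em[of X] eq by (simp add: Int_absorb2)
  qed (use M N in simp)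
qed

lemma copula_measure_eqI: "represents M C \<Longrightarrow> copula_measure C = M"
  unfolding copula_measure_def represents_def[symmetric]
  by (rule the_equality) (auto intro: represents_unique)

text \<open>Monotonicity and additivity of the measure give everything except the two margins; the
  zero boundary values are squeezed between 0 and a margin at 0. All copulas constructed below are
  recognised this way.\<close>

lemma represents_copula:
  assumes M: "represents M C"
    and m1: "\<And>u. u \<in> {0..1} \<Longrightarrow> C u 1 = u" and m2: "\<And>v. v \<in> {0..1} \<Longrightarrow> C 1 v = v"
  shows "copula C"
proof -
  interpret M: prob_space M using M by (simp add: represents_def)
  have sets: "sets M = sets square_borel" and C: "\<And>u v. u \<in> {0..1} \<Longrightarrow> v \<in> {0..1} \<Longrightarrow> C u v = measure M ({0..u} \<times> {0..v})"
    using M by (auto simp: represents_def)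
  have R: "{0..u} \<times> {0..v} \<in> sets M" if "u \<in> {0..1}" "v \<in> {0..1}" for u v
    using that rect_in_square_borel sets by auto
  have mono: "C u v \<le> C u' v'" if "u \<in> {0..1}" "v \<in> {0..1}" "u' \<in> {0..1}" "v' \<in> {0..1}" "u \<le> u'" "v \<le> v'" for u v u' v'
    using that unfolding C[OF that(1,2)] C[OF that(3,4)]
    by (intro M.finite_measure_mono R) auto
  have nn: "0 \<le> C u v" if "u \<in> {0..1}" "v \<in> {0..1}" for u v
    using that C by simp
  show ?thesis
    unfolding copula_def
  proof (intro conjI ballI impI)
    fix u v :: real assume "u \<in> {0..1}" "v \<in> {0..1}"
    then show "C u v \<in> {0..1}" using nn C by auto
  next
    fix v :: real assume v: "v \<in> {0..1}"
    show "C 0 v = 0" using mono[of 0 v 0 1] nn[of 0 v] m1[of 0] v by auto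
  next
    fix u :: real assume u: "u \<in> {0..1}"
    show "C u 0 = 0" using mono[of u 0 1 0] nn[of u 0] m2[of 0] u by auto
  next
    fix u1 u2 v1 v2 :: real
    assume a: "u1 \<in> {0..1}" "u2 \<in> {0..1}" "v1 \<in> {0..1}" "v2 \<in> {0..1}" "u1 \<le> u2" "v1 \<le> v2"
    let ?R = "\<lambda>u v. {0..u::real} \<times> {0..v::real}"
    \<comment> \<open>Inclusion-exclusion for two overlapping rectangles inside the one with corner
      \<open>(u2, v2)\<close>; their intersection has corner \<open>(u1, v1)\<close>.\<close>
    have "measure M (?R u2 v1 \<union> ?R u1 v2) = C u2 v1 + measure M (?R u1 v2 - ?R u2 v1)"
      using a R C by (subst M.finite_measure_Union') auto
    moreover have "measure M (?R u1 v2) = measure M (?R u1 v2 - ?R u2 v1) + measure M (?R u1 v1)"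
    proof -
      have "?R u1 v2 \<inter> ?R u2 v1 = ?R u1 v1"
        using a by auto
      then show ?thesis
        using M.finite_measure_Diff'[OF R R, of u1 v2 u2 v1] a by simp
    qed
    moreover have "measure M (?R u2 v1 \<union> ?R u1 v2) \<le> measure M (?R u2 v2)"
      using a R by (intro M.finite_measure_mono) auto
    ultimately show "C u2 v2 - C u2 v1 - C u1 v2 + C u1 v1 \<ge> 0"
      using a C by simp
  qed (use m1 m2 in auto)
qed

section \<open>Monotonicity and Lipschitz bounds for copulas\<close>

lemma
  assumes "copula C"
  shows copula_0_left: "v \<in> {0..1} \<Longrightarrow> C 0 v = 0"
    and copula_0_right: "u \<in> {0..1} \<Longrightarrow> C u 0 = 0"
    and copula_1_left: "v \<in> {0..1} \<Longrightarrow> C 1 v = v"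
    and copula_1_right: "u \<in> {0..1} \<Longrightarrow> C u 1 = u"
  using assms unfolding copula_def by blast+

lemma copula_2_increasing:
  assumes "copula C" "u1 \<in> {0..1}" "u2 \<in> {0..1}" "v1 \<in> {0..1}" "v2 \<in> {0..1}" "u1 \<le> u2" "v1 \<le> v2"
  shows "C u2 v1 - C u1 v1 \<le> C u2 v2 - C u1 v2"
proof -
  have "C u2 v2 - C u2 v1 - C u1 v2 + C u1 v1 \<ge> 0"
    using assms unfolding copula_def by blast
  then show ?thesis by linarith
qed

text \<open>Increments in \<open>u\<close> grow with \<open>v\<close>, so they lie between those at
  \<open>v = 0\<close> and \<open>v = 1\<close>, which are 0 and \<open>u2 - u1\<close>.\<close>

lemma copula_increment_left:
  assumes C: "copula C" and "u1 \<in> {0..1}" "u2 \<in> {0..1}" "v \<in> {0..1}" "u1 \<le> u2"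
  shows "0 \<le> C u2 v - C u1 v" "C u2 v - C u1 v \<le> u2 - u1"
  using copula_2_increasing[OF C assms(2,3), of 0 v] copula_2_increasing[OF C assms(2,3), of v 1]
    assms copula_0_right[OF C] copula_1_right[OF C] by auto

lemma copula_increment_right:
  assumes C: "copula C" and "v1 \<in> {0..1}" "v2 \<in> {0..1}" "u \<in> {0..1}" "v1 \<le> v2"
  shows "0 \<le> C u v2 - C u v1" "C u v2 - C u v1 \<le> v2 - v1"
  using copula_2_increasing[OF C, of 0 u v1 v2] copula_2_increasing[OF C, of u 1 v1 v2]
    assms copula_0_left[OF C] copula_1_left[OF C] by (auto simp: algebra_simps)

lemma copula_lipschitz:
  assumes C: "copula C" and "u \<in> {0..1}" "u' \<in> {0..1}" "v \<in> {0..1}" "v' \<in> {0..1}"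
  shows "\<bar>C u v - C u' v'\<bar> \<le> \<bar>u - u'\<bar> + \<bar>v - v'\<bar>"
proof -
  have "\<bar>C u v - C u' v\<bar> \<le> \<bar>u - u'\<bar>"
    using copula_increment_left[OF C, of u u' v] copula_increment_left[OF C, of u' u v] assms
    by (cases "u \<le> u'") (auto simp: abs_if)
  moreover have "\<bar>C u' v - C u' v'\<bar> \<le> \<bar>v - v'\<bar>"
    using copula_increment_right[OF C, of v v' u'] copula_increment_right[OF C, of v' v u'] assms
    by (cases "v \<le> v'") (auto simp: abs_if)
  ultimately show ?thesis by linarith
qed

lemma copula_continuous_on:
  assumes C: "copula C"
  shows "continuous_on unit_square (\<lambda>p. C (fst p) (snd p))"
proof (rule lipschitz_on_continuous_on)
  show "2-lipschitz_on unit_square (\<lambda>p. C (fst p) (snd p))"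
  proof (rule lipschitz_onI)
    fix p q assume "p \<in> unit_square" "q \<in> unit_square"
    then have "\<bar>C (fst p) (snd p) - C (fst q) (snd q)\<bar> \<le> \<bar>fst p - fst q\<bar> + \<bar>snd p - snd q\<bar>"
      by (intro copula_lipschitz[OF C]) auto
    also have "\<dots> \<le> dist p q + dist p q"
      using dist_fst_le[of p q] dist_snd_le[of p q] by (intro add_mono) (auto simp: dist_real_def)
    finally show "dist (C (fst p) (snd p)) (C (fst q) (snd q)) \<le> 2 * dist p q"
      by (simp add: dist_real_def)
  qed simp
qed

section \<open>Measures on the line dominated by the uniform distribution\<close>

definition clamp01 :: "real \<Rightarrow> real" where
  "clamp01 x = max 0 (min 1 x)"

lemma clamp01_simps [simp]: "clamp01 x \<in> {0..1}" "0 \<le> clamp01 x" "clamp01 x \<le> 1"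
  and clamp01_id: "x \<in> {0..1} \<Longrightarrow> clamp01 x = x"
  and clamp01_mono: "x \<le> y \<Longrightarrow> clamp01 x \<le> clamp01 y"
  and clamp01_lipschitz: "\<bar>clamp01 x - clamp01 y\<bar> \<le> \<bar>x - y\<bar>"
  by (auto simp: clamp01_def)

definition unif :: "real measure" where
  "unif = density lborel (indicator {0..1})"

lemma sets_unif [simp, measurable_cong]: "sets unif = sets borel"
  and space_unif [simp]: "space unif = UNIV"
  by (auto simp: unif_def)

lemma emeasure_unif: "X \<in> sets borel \<Longrightarrow> emeasure unif X = emeasure lborel (X \<inter> {0..1})"
  by (auto simp: unif_def emeasure_density indicator_inter_arith[symmetric] Int_commute)

lemma emeasure_unif_atMost: "emeasure unif {..x} = ennreal (clamp01 x)"
proof -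
  have "{..x} \<inter> {0..1} = (if x < 0 then {} else {0..min x 1})" by auto
  then show ?thesis by (auto simp: emeasure_unif clamp01_def min_def max_def ennreal_neg)
qed

lemma prob_space_unif: "prob_space unif"
  by standard (simp add: emeasure_unif)

text \<open>The sum measure \<open>S\<close> has the distribution function of \<open>L\<close>, and
  a finite Borel measure is determined by its distribution function. This gives domination by
  \<open>unif\<close> and additivity of densities.\<close>

lemma emeasure_add_of_cdf_add:
  fixes L M N :: "real measure"
  assumes fin: "finite_borel_measure L" "finite_borel_measure M" "finite_borel_measure N"
    and cdf: "\<And>x. cdf L x = cdf M x + cdf N x" and X: "X \<in> sets borel"
  shows "emeasure L X = emeasure M X + emeasure N X"
proof -
  interpret L: finite_borel_measure L by fact
  interpret M: finite_borel_measure M by fact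
  interpret N: finite_borel_measure N by fact
  let ?\<mu> = "\<lambda>X. emeasure M X + emeasure N X"
  define S where "S = measure_of UNIV (sets borel) ?\<mu>"
  have sets: "sets S = sets borel" "space S = UNIV"
    unfolding S_def using sets.sigma_sets_eq[of "borel :: real measure"] by auto
  have em: "emeasure S X = ?\<mu> X" if "X \<in> sets borel" for X
  proof (rule emeasure_measure_of[OF S_def])
    show "countably_additive (sets S) ?\<mu>"
      unfolding countably_additive_def
      using sets by (auto simp: suminf_add[symmetric] suminf_emeasure M.M_is_borel N.M_is_borel)
  qed (use that sets in \<open>auto simp: positive_def\<close>)
  interpret S: finite_measure S
    by (rule finite_measureI) (use M.emeasure_finite N.emeasure_finite in \<open>simp add: sets em\<close>)
  have "finite_borel_measure S"
    by standard (simp add: sets)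
  moreover have "cdf S x = cdf M x + cdf N x" for x
    by (simp add: cdf_def measure_def em enn2real_plus less_top[symmetric] M.emeasure_finite N.emeasure_finite)
  then have "cdf L = cdf S"
    using cdf by (simp add: fun_eq_iff)
  ultimately have "L = S"
    using fin(1) by (intro cdf_unique') auto
  then show ?thesis using em X by simp
qed

text \<open>These are the distribution functions on the unit interval of the measures dominated by
  \<open>unif\<close>. Sections of a copula are of this kind, and so are differences of
  sections.\<close>

definition lip_growth :: "(real \<Rightarrow> real) \<Rightarrow> bool" where
  "lip_growth G \<longleftrightarrow> G 0 = 0 \<and> (\<forall>x\<in>{0..1}. \<forall>y\<in>{0..1}. x \<le> y \<longrightarrow> 0 \<le> G y - G x \<and> G y - G x \<le> y - x)"

lemma lip_growthI:
  assumes "G 0 = 0"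
    and "\<And>x y. x \<in> {0..1} \<Longrightarrow> y \<in> {0..1} \<Longrightarrow> x \<le> y \<Longrightarrow> 0 \<le> G y - G x"
    and "\<And>x y. x \<in> {0..1} \<Longrightarrow> y \<in> {0..1} \<Longrightarrow> x \<le> y \<Longrightarrow> G y - G x \<le> y - x"
  shows "lip_growth G"
  using assms by (simp add: lip_growth_def)

lemma lip_growth_complement:
  assumes G: "lip_growth G"
  shows "lip_growth (\<lambda>x. x - G x)"
proof (rule lip_growthI)
  fix x y :: real assume "x \<in> {0..1}" "y \<in> {0..1}" "x \<le> y"
  then have "0 \<le> G y - G x" "G y - G x \<le> y - x"
    using G unfolding lip_growth_def by blast+
  then show "0 \<le> y - G y - (x - G x)" "y - G y - (x - G x) \<le> y - x" by linarith+
qed (use G in \<open>simp add: lip_growth_def\<close>)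

text \<open>Only the values of \<open>G\<close> on the unit interval are controlled; clamping
  extends it by constants, so that no mass lies outside.\<close>

abbreviation growth_measure :: "(real \<Rightarrow> real) \<Rightarrow> real measure" where
  "growth_measure G \<equiv> interval_measure (\<lambda>x. G (clamp01 x))"

lemma
  assumes G: "lip_growth G"
  shows finite_growth_measure: "finite_borel_measure (growth_measure G)"
    and cdf_growth_measure: "cdf (growth_measure G) x = G (clamp01 x)"
proof -
  have inc: "0 \<le> G y - G x" "G y - G x \<le> y - x" if "x \<in> {0..1}" "y \<in> {0..1}" "x \<le> y" for x y
    using G that by (auto simp: lip_growth_def)
  have mono: "G (clamp01 x) \<le> G (clamp01 y)" if "x \<le> y" for x y
    using inc[of "clamp01 x" "clamp01 y"] clamp01_mono[OF that] by simp
  have lip: "\<bar>G (clamp01 x) - G (clamp01 y)\<bar> \<le> \<bar>x - y\<bar>" for x y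
    using inc[of "clamp01 x" "clamp01 y"] inc[of "clamp01 y" "clamp01 x"] clamp01_lipschitz[of x y]
    by (cases "clamp01 x \<le> clamp01 y") (auto simp: abs_if split: if_splits)
  have "continuous_on UNIV (\<lambda>x. G (clamp01 x))"
    by (rule lipschitz_on_continuous_on[where L = 1]) (auto intro!: lipschitz_onI simp: dist_real_def lip)
  then have cont: "continuous (at_right a) (\<lambda>x. G (clamp01 x))" for a
    by (simp add: continuous_on_eq_continuous_at continuous_at_imp_continuous_at_within)
  have "eventually (\<lambda>x. G (clamp01 x) = 0) at_bot"
    using G by (auto simp: eventually_at_bot_linorder lip_growth_def clamp01_def intro!: exI[of _ 0])
  then have bot: "((\<lambda>x. G (clamp01 x)) \<longlongrightarrow> 0) at_bot"
    by (rule tendsto_eventually)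
  have "eventually (\<lambda>x. G (clamp01 x) = G 1) at_top"
    by (auto simp: eventually_at_top_linorder clamp01_def intro!: exI[of _ 1])
  then have top: "((\<lambda>x. G (clamp01 x)) \<longlongrightarrow> G 1) at_top"
    by (rule tendsto_eventually)
  show "finite_borel_measure (growth_measure G)"
    using inc[of 0 1] G
    by (intro finite_borel_measure_interval_measure[OF mono cont bot top]) (auto simp: lip_growth_def)
  show "cdf (growth_measure G) x = G (clamp01 x)"
    unfolding cdf_def by (rule measure_interval_measure_Iic[OF mono cont bot])
qed

lemma finite_borel_measure_unif: "finite_borel_measure unif"
proof -
  interpret prob_space unif by (rule prob_space_unif)
  show ?thesis by standard simp_all
qed

lemma cdf_unif: "cdf unif x = clamp01 x"
  by (simp add: cdf_def measure_def emeasure_unif_atMost)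

text \<open>The measures belonging to \<open>G\<close> and to \<open>x - G x\<close> add up to
  \<open>unif\<close>. Hence the first is dominated by \<open>unif\<close>, and the Radon-Nikodym
  theorem applies.\<close>

lemma growth_density_exists:
  assumes G: "lip_growth G"
  obtains h where "h \<in> borel_measurable borel" "density unif h = growth_measure G"
proof -
  have G': "lip_growth (\<lambda>x. x - G x)"
    using G by (rule lip_growth_complement)
  have "emeasure unif X = emeasure (growth_measure G) X + emeasure (growth_measure (\<lambda>x. x - G x)) X"
    if "X \<in> sets borel" for X
    using that by (intro emeasure_add_of_cdf_add finite_borel_measure_unif finite_growth_measure G G')
      (simp_all add: cdf_unif cdf_growth_measure[OF G] cdf_growth_measure[OF G'])
  then have ac: "absolutely_continuous unif (growth_measure G)"
    by (auto simp: absolutely_continuous_def null_sets_def)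
  then obtain h where "h \<in> borel_measurable unif" "density unif h = growth_measure G"
    using prob_space_imp_sigma_finite[OF prob_space_unif] sigma_finite_measure.Radon_Nikodym[OF _ ac] by auto
  then show ?thesis by (intro that) auto
qed

text \<open>The difference \<open>G' - G\<close> has a density \<open>k\<close> of its own, so
  \<open>h' = h + k\<close> almost everywhere by uniqueness of densities, and \<open>k\<close> is
  nonnegative by its type.\<close>

lemma growth_density_mono:
  assumes G: "lip_growth G" and G': "lip_growth G'" and d: "lip_growth (\<lambda>x. G' x - G x)"
    and h [measurable]: "h \<in> borel_measurable borel" "h' \<in> borel_measurable borel"
    and dens: "density unif h = growth_measure G" "density unif h' = growth_measure G'"
  shows "AE x in unif. h x \<le> h' x"
proof -
  interpret prob_space unif by (rule prob_space_unif)
  obtain k where k [measurable]: "k \<in> borel_measurable borel" and kd: "density unif k = growth_measure (\<lambda>x. G' x - G x)"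
    using growth_density_exists[OF d] .
  have "density unif h' = density unif (\<lambda>x. h x + k x)"
  proof (rule measure_eqI)
    fix X assume "X \<in> sets (density unif h')"
    then have X [measurable]: "X \<in> sets borel" by simp
    have "emeasure (density unif h') X = emeasure (density unif h) X + emeasure (density unif k) X"
      unfolding dens kd using X
      by (intro emeasure_add_of_cdf_add finite_growth_measure G G' d)
        (simp_all add: cdf_growth_measure[OF G] cdf_growth_measure[OF G'] cdf_growth_measure[OF d])
    also have "\<dots> = emeasure (density unif (\<lambda>x. h x + k x)) X"
      by (simp add: emeasure_density nn_integral_add[symmetric] distrib_right)
    finally show "emeasure (density unif h') X = emeasure (density unif (\<lambda>x. h x + k x)) X" .
  qed simp
  then have "AE x in unif. h' x = h x + k x"
    by (intro density_unique) auto
  then show ?thesis by (rule AE_mp) (auto intro!: AE_I2)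
qed


lemma nn_integral_growth_density:
  assumes "u \<in> {0..1}" and G: "lip_growth G" and d: "density unif h = growth_measure G" "h \<in> borel_measurable borel"
  shows "(\<integral>\<^sup>+x. h x * indicator {..u} x \<partial>unif) = ennreal (G u)"
proof -
  interpret finite_borel_measure "growth_measure G" by (rule finite_growth_measure[OF G])
  have "(\<integral>\<^sup>+x. h x * indicator {..u} x \<partial>unif) = emeasure (growth_measure G) {..u}"
    unfolding d(1)[symmetric] using d(2) by (simp add: emeasure_density)
  also have "\<dots> = ennreal (G u)"
    using cdf_growth_measure[OF G, of u] assms(1) by (simp add: cdf_def emeasure_eq_measure clamp01_id)
  finally show ?thesis .
qed

lemma copula_section_lip_growth:
  assumes C: "copula C" and "q \<in> {0..1}"
  shows "lip_growth (\<lambda>x. C x q)"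
  using copula_increment_left[OF C _ _ assms(2)] copula_0_left[OF C assms(2)] unfolding lip_growth_def by auto

lemma copula_section_diff_lip_growth:
  assumes C: "copula C" and q: "q \<in> {0..1}" "q' \<in> {0..1}" "q \<le> q'"
  shows "lip_growth (\<lambda>x. C x q' - C x q)"
proof (rule lip_growthI)
  fix x y :: real assume "x \<in> {0..1}" "y \<in> {0..1}" "x \<le> y"
  then show "0 \<le> C y q' - C y q - (C x q' - C x q)" "C y q' - C y q - (C x q' - C x q) \<le> y - x"
    using copula_increment_left[OF C, of x y q] copula_increment_left[OF C, of x y q']
      copula_2_increasing[OF C, of x y q q'] q by linarith+
qed (use copula_0_left[OF C q(1)] copula_0_left[OF C q(2)] in simp)

text \<open>Disintegration: the conditional distribution functions of the second coordinate are the
  densities of the sections \<open>u \<mapsto> C u q\<close> for rational \<open>q\<close>, and the second coordinate is sampled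
  as their quantile at an independent uniform variable.\<close>

lemma copula_represented:
  assumes C: "copula C"
  shows "\<exists>M. represents M C"
proof -
  \<comment> \<open>Countability allows the exceptional null sets of all levels to be united; the
    member 1 keeps the infimum defining \<open>V\<close> at most 1.\<close>
  define I :: "real set" where "I = \<rat> \<inter> {0..1}"
  have I: "countable I" "1 \<in> I" "\<And>q. q \<in> I \<Longrightarrow> q \<in> {0..1}"
    using countable_rat by (auto simp: I_def)
  have "\<exists>h. h \<in> borel_measurable borel \<and> density unif h = growth_measure (\<lambda>x. C x q)" if "q \<in> I" for q
    using growth_density_exists[OF copula_section_lip_growth[OF C I(3)[OF that]]] by metis
  then obtain h where h [measurable]: "\<And>q. q \<in> I \<Longrightarrow> h q \<in> borel_measurable borel"
    and dens: "\<And>q. q \<in> I \<Longrightarrow> density unif (h q) = growth_measure (\<lambda>x. C x q)"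
    by metis
  have mono: "AE x in unif. h q x \<le> h q' x" if "q \<in> I" "q' \<in> I" "q \<le> q'" for q q'
    using that I(3) by (intro growth_density_mono[OF _ _ _ h h dens dens] copula_section_lip_growth
       copula_section_diff_lip_growth C) auto
  have le1: "AE x in unif. h q x \<le> 1" if "q \<in> I" for q
  proof (rule growth_density_mono[OF _ _ _ h _ dens])
    show "lip_growth (\<lambda>x. C x q)" "q \<in> I" "q \<in> I" using that I C by (auto intro: copula_section_lip_growth)
    show id: "lip_growth (\<lambda>x. x)" by (auto simp: lip_growth_def)
    show "lip_growth (\<lambda>x. x - C x q)" 
      by (intro lip_growth_complement copula_section_lip_growth C I(3) that)
    have "unif = growth_measure (\<lambda>x. x)"
      by (intro cdf_unique' finite_borel_measure_unif finite_growth_measure id)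
        (simp add: fun_eq_iff cdf_unif cdf_growth_measure[OF id])
    then show "density unif (\<lambda>_. 1) = growth_measure (\<lambda>x. x)"
      by (simp add: density_1)
  qed auto
  interpret U: prob_space unif by (rule prob_space_unif)
  interpret P: pair_prob_space unif unif ..
  define \<Omega> where "\<Omega> = unif \<Otimes>\<^sub>M unif"
  interpret \<Omega>: prob_space \<Omega> unfolding \<Omega>_def by (rule P.prob_space_axioms)
  have sets_\<Omega> [measurable_cong]: "sets \<Omega> = sets (borel \<Otimes>\<^sub>M borel)" 
    unfolding \<Omega>_def by (intro sets_pair_measure_cong) simp_all
  have space_\<Omega> [simp]: "space \<Omega> = UNIV" by (simp add: \<Omega>_def space_pair_measure)
  have AE_fst: "AE p in \<Omega>. Q (fst p)" if [measurable]: "Measurable.pred borel Q" and "AE x in unif. Q x" for Q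
    unfolding \<Omega>_def
  proof (rule P.AE_pair_measure)
    show "{p \<in> space (unif \<Otimes>\<^sub>M unif). Q (fst p)} \<in> sets (unif \<Otimes>\<^sub>M unif)"
      by measurable
  qed (use that(2) in auto)
  \<comment> \<open>\<open>h q x\<close> plays the role of the conditional probability that the
    second coordinate is at most \<open>q\<close>, and \<open>V\<close> is its quantile at
    \<open>snd p\<close>. The default 1 is neutral, since the index \<open>q = 1\<close> contributes
    1 in either case.\<close>
  define V where "V p = (INF q\<in>I. if ennreal (snd p) \<le> h q (fst p) then q else 1)" for p
  have [measurable]: "V \<in> borel_measurable \<Omega>"
    unfolding V_def using I(1) by measurable
  have bdd: "bdd_below ((\<lambda>q. if ennreal (snd p) \<le> h q (fst p) then q else 1) ` I)" for p
    using I by (intro bdd_belowI[of _ 0]) auto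
  have V01: "V p \<in> {0..1}" for p
  proof -
    have "V p \<le> (if ennreal (snd p) \<le> h 1 (fst p) then 1 else 1)"
      unfolding V_def using I by (intro cINF_lower bdd) auto
    moreover have "0 \<le> V p" unfolding V_def using I by (intro cINF_greatest) auto
    ultimately show ?thesis by auto
  qed
  define S where "S q u = {p. fst p \<le> u \<and> ennreal (snd p) \<le> h q (fst p)}" for q u
  have S [measurable]: "S q u \<in> sets \<Omega>" if "q \<in> I" for q u
  proof -
    have [measurable]: "h q \<in> borel_measurable borel" using that by (rule h)
    have "{p \<in> space \<Omega>. fst p \<le> u \<and> ennreal (snd p) \<le> h q (fst p)} \<in> sets \<Omega>"
      by measurable
    then show ?thesis by (simp add: S_def)
  qed
  have em_S: "emeasure \<Omega> (S q u) = ennreal (C u q)" if q: "q \<in> I" and u: "u \<in> {0..1}" for q u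
  proof -
    have "emeasure \<Omega> (S q u) = (\<integral>\<^sup>+x. emeasure unif (Pair x -` S q u) \<partial>unif)"
      using S[OF q] unfolding \<Omega>_def by (rule U.emeasure_pair_measure_alt)
    \<comment> \<open>Since \<open>h q x\<close> is at most 1 almost everywhere, the slice of
      \<open>S q u\<close> over \<open>x\<close> below \<open>u\<close> is a half-line of uniform
      mass \<open>h q x\<close>.\<close>
    also have "\<dots> = (\<integral>\<^sup>+x. h q x * indicator {..u} x \<partial>unif)"
    proof (rule nn_integral_cong_AE, use le1[OF q] in eventually_elim)
      case (elim x)
      obtain r where r: "h q x = ennreal r" "0 \<le> r" "r \<le> 1"
        using elim by (cases "h q x") (auto simp: top_unique)
      have "Pair x -` S q u = (if x \<le> u then {..r} else {})"
        using r by (auto simp: S_def ennreal_le_iff)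
      then show ?case using r by (simp add: emeasure_unif_atMost clamp01_id)
    qed
    also have "\<dots> = ennreal (C u q)"
      using q u I(3)[OF q] by (intro nn_integral_growth_density copula_section_lip_growth C dens h)
    finally show ?thesis .
  qed
  have meas_S: "\<Omega>.prob (S q u) = C u q" if q: "q \<in> I" and u: "u \<in> {0..1}" for q u
    using em_S[OF that] C I(3)[OF q] u unfolding copula_def by (simp add: measure_def)
  define R where "R u v = {p. fst p \<le> u \<and> V p \<le> v}" for u v
  have R [measurable]: "R u v \<in> sets \<Omega>" for u v
  proof -
    have "{p \<in> space \<Omega>. fst p \<le> u \<and> V p \<le> v} \<in> sets \<Omega>"
      by measurable
    then show ?thesis by (simp add: R_def)
  qed
  \<comment> \<open>The event \<open>R u v\<close> is enclosed between events of rational level: it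
    contains \<open>S q u\<close> for \<open>q \<le> v\<close> and lies in \<open>S q u\<close>
    almost surely for \<open>v < q\<close>. The Lipschitz bound in \<open>v\<close> then closes the
    gap.\<close>
  have lower: "C u q \<le> \<Omega>.prob (R u v)" if "q \<in> I" "q \<le> v" "u \<in> {0..1}" for u q v
  proof -
    have "V p \<le> v" if "ennreal (snd p) \<le> h q (fst p)" for p
      unfolding V_def using \<open>q \<in> I\<close> \<open>q \<le> v\<close> that by (intro cINF_lower2[OF bdd]) auto
    then have "S q u \<subseteq> R u v"
      by (auto simp: R_def S_def)
    then show ?thesis
      using that by (subst meas_S[symmetric]) (auto intro!: \<Omega>.finite_measure_mono)
  qed
  have upper: "\<Omega>.prob (R u v) \<le> C u q" if "q \<in> I" "v < q" "u \<in> {0..1}" for u q v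
  proof -
    have "AE p in \<Omega>. \<forall>q'\<in>I. q' \<le> q \<longrightarrow> h q' (fst p) \<le> h q (fst p)"
      using that mono by (auto simp: AE_ball_countable[OF I(1)] intro!: AE_fst)
    then have "AE p in \<Omega>. p \<in> R u v \<longrightarrow> p \<in> S q u"
    proof eventually_elim
      case (elim p)
      show ?case
      proof
        assume "p \<in> R u v"
        then have "fst p \<le> u" "V p < q" using that by (auto simp: R_def)
        then obtain q' where q': "q' \<in> I" "(if ennreal (snd p) \<le> h q' (fst p) then q' else 1) < q"
          unfolding V_def using I bdd by (subst (asm) cINF_less_iff) auto
        moreover have "q \<le> 1" using that I by auto
        ultimately have "ennreal (snd p) \<le> h q' (fst p)" "q' < q" by (auto split: if_splits)
        then show "p \<in> S q u" using elim q' \<open>fst p \<le> u\<close> by (auto simp: S_def intro: order_trans)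
      qed
    qed
    then show ?thesis
      using that by (subst meas_S[symmetric]) (auto intro!: \<Omega>.finite_measure_mono_AE)
  qed
  have prob_R: "\<Omega>.prob (R u v) = C u v" if u: "u \<in> {0..1}" and v: "v \<in> {0..1}" for u v
  proof (rule antisym)
    show "\<Omega>.prob (R u v) \<le> C u v"
    \<comment> \<open>No member of \<open>I\<close> exceeds 1, so \<open>upper\<close> says nothing
      at \<open>v = 1\<close> and the margin is computed directly. Below, \<open>v = 0\<close> is
      separated for the same reason.\<close>
    proof (cases "v = 1")
      case True
      have "R u 1 = {..u} \<times> UNIV" using V01 by (auto simp: R_def)
      then have "emeasure \<Omega> (R u 1) = ennreal u"
        using u U.emeasure_space_1 unfolding \<Omega>_def
        by (simp add: U.emeasure_pair_measure_Times emeasure_unif_atMost clamp01_id)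
      then show ?thesis using True u copula_1_right[OF C u] by (simp add: measure_def)
    next
      case False
      show ?thesis
      proof (rule field_le_epsilon)
        fix e :: real assume "0 < e"
        then obtain q where q: "q \<in> \<rat>" "v < q" "q < min 1 (v + e)"
          using Rats_dense_in_real[of v "min 1 (v + e)"] v False by auto
        then have "q \<in> I" using v by (auto simp: I_def)
        then show "\<Omega>.prob (R u v) \<le> C u v + e"
          using upper[of q v u] copula_increment_right[OF C v, of q u] q u v by auto
      qed
    qed
    show "C u v \<le> \<Omega>.prob (R u v)"
    proof (cases "v = 0")
      case True
      then show ?thesis using copula_0_right[OF C u] by simp
    next
      case False
      show ?thesis
      proof (rule field_le_epsilon)
        fix e :: real assume "0 < e"
        then obtain q where q: "q \<in> \<rat>" "max 0 (v - e) < q" "q < v"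
          using Rats_dense_in_real[of "max 0 (v - e)" v] v False by auto
        then have "q \<in> I" using v by (auto simp: I_def)
        then show "C u v \<le> \<Omega>.prob (R u v) + e"
          using lower[of q v u] copula_increment_right[OF C _ v, of q u] q u v by auto
      qed
    qed
  qed
  \<comment> \<open>\<open>unif\<close> charges only the unit interval, so clamping changes nothing
    almost surely while putting every value into the square.\<close>
  define X where "X p = (clamp01 (fst p), V p)" for p
  have X [measurable]: "X \<in> measurable \<Omega> square_borel"
  proof (rule measurable_restrict_space2)
    show "X \<in> measurable \<Omega> borel" unfolding X_def clamp01_def borel_prod[symmetric] by measurable
  qed (use V01 in \<open>auto simp: X_def\<close>)
  have "represents (distr \<Omega> square_borel X) C"
    unfolding represents_def
  proof (intro conjI ballI)
    show "prob_space (distr \<Omega> square_borel X)" by (rule \<Omega>.prob_space_distr) (rule X)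
    fix u v :: real assume u: "u \<in> {0..1}" and v: "v \<in> {0..1}"
    have "measure (distr \<Omega> square_borel X) ({0..u} \<times> {0..v}) = \<Omega>.prob (X -` ({0..u} \<times> {0..v}))"
      using u v by (subst measure_distr[OF X rect_in_square_borel]) auto
    also have "\<dots> = \<Omega>.prob (R u v)"
    proof (rule \<Omega>.finite_measure_eq_AE)
      have "AE x in unif. x \<le> 1" unfolding unif_def by (subst AE_density) (auto intro!: AE_I2 simp: indicator_def split: if_splits)
      then have "AE p in \<Omega>. fst p \<le> 1" using AE_fst[of "\<lambda>x. x \<le> 1"] by simp
      then show "AE p in \<Omega>. p \<in> X -` ({0..u} \<times> {0..v}) \<longleftrightarrow> p \<in> R u v"
        by eventually_elim (use u v V01 in \<open>auto simp: X_def R_def clamp01_def\<close>)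
      show "X -` ({0..u} \<times> {0..v}) \<in> \<Omega>.events"
        using measurable_sets[OF X rect_in_square_borel[of u v]] u v by simp
    qed (rule R)
    finally show "measure (distr \<Omega> square_borel X) ({0..u} \<times> {0..v}) = C u v"
      by (simp add: prob_R[OF u v])
  qed simp
  then show ?thesis by blast
qed

text \<open>Only the open interval matters for \<open>h\<close>, so breakpoints of piecewise
  functions need no care. The value is a variable \<open>I\<close> with an equation so that it can
  be matched against a simplified constant.\<close>

lemma has_integral_affine_piece:
  fixes h :: "real \<Rightarrow> real"
  assumes "a \<le> b" and h: "\<And>x. a < x \<Longrightarrow> x < b \<Longrightarrow> h x = m * x + c"
    and I: "I = m * (b\<^sup>2 - a\<^sup>2) / 2 + c * (b - a)"
  shows "(h has_integral I) {a..b}"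
proof -
  have "((\<lambda>x. m * x + c) has_integral (m * ((b\<^sup>2 - a\<^sup>2) / 2) + (b - a) *\<^sub>R c)) {a..b}"
    by (intro has_integral_add has_integral_mult_right ident_has_integral \<open>a \<le> b\<close>)
      (use has_integral_const_real[of c a b] \<open>a \<le> b\<close> in simp)
  then have "((\<lambda>x. m * x + c) has_integral I) (cbox a b)"
    by (simp add: I algebra_simps)
  then have "(h has_integral I) (cbox a b)"
    by (rule has_integral_spike_interior) (use h in auto)
  then show ?thesis by simp
qed

subsection \<open>The inequalities\<close>

text \<open>By Tonelli, integrating over \<open>t\<close> first gives the length of the interval
  from \<open>X\<close> to \<open>Y\<close>. The bounds on \<open>X\<close> and \<open>Y\<close>
  confine that interval to \<open>{0..1}\<close>. With it, integrals of a copula along a curve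
  become expectations.\<close>

lemma (in prob_space) has_integral_prob_between:
  fixes X Y :: "'a \<Rightarrow> real"
  assumes X [measurable]: "X \<in> borel_measurable M" and Y [measurable]: "Y \<in> borel_measurable M"
    and bounds: "\<And>p. p \<in> space M \<Longrightarrow> 0 \<le> X p" "\<And>p. p \<in> space M \<Longrightarrow> Y p \<le> 1"
  shows "((\<lambda>t. prob {p \<in> space M. X p \<le> t \<and> t \<le> Y p}) has_integral expectation (\<lambda>p. max 0 (Y p - X p))) {0..1}"
proof -
  interpret P: pair_sigma_finite M lborel ..
  let ?f = "\<lambda>t. prob {p \<in> space M. X p \<le> t \<and> t \<le> Y p}"
  have em: "ennreal (?f t) = (\<integral>\<^sup>+p. indicator {(p, t). X p \<le> t \<and> t \<le> Y p} (p, t) \<partial>M)" for t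
  proof -
    have "(\<integral>\<^sup>+p. indicator {(p, t). X p \<le> t \<and> t \<le> Y p} (p, t) \<partial>M) =
      (\<integral>\<^sup>+p. indicator {p \<in> space M. X p \<le> t \<and> t \<le> Y p} p \<partial>M)"
      by (intro nn_integral_cong) (auto simp: indicator_def)
    also have "\<dots> = emeasure M {p \<in> space M. X p \<le> t \<and> t \<le> Y p}"
      by (intro nn_integral_indicator) measurable
    finally show ?thesis by (simp add: emeasure_eq_measure)
  qed
  have [measurable]: "(\<lambda>z. indicator {(p, t). X p \<le> t \<and> t \<le> Y p} z :: ennreal) \<in> borel_measurable (M \<Otimes>\<^sub>M lborel)"
  proof -
    have "{z \<in> space (M \<Otimes>\<^sub>M lborel). X (fst z) \<le> snd z \<and> snd z \<le> Y (fst z)} \<in> sets (M \<Otimes>\<^sub>M lborel)"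
      by measurable
    then show ?thesis
      by (subst measurable_cong[where g = "indicator {z \<in> space (M \<Otimes>\<^sub>M lborel). X (fst z) \<le> snd z \<and> snd z \<le> Y (fst z)}"])
        (auto simp: indicator_def)
  qed
  have Y_X: "Y p - X p \<le> 1" if "p \<in> space M" for p
    using bounds[OF that] by linarith
  have int: "integrable M (\<lambda>p. max 0 (Y p - X p))"
    by (rule integrable_const_bound[where B = 1]) (use Y_X in \<open>auto intro!: AE_I2\<close>)
  have "(\<integral>\<^sup>+t. ennreal (?f t) \<partial>lborel) =
      (\<integral>\<^sup>+t. (\<integral>\<^sup>+p. indicator {(p, t). X p \<le> t \<and> t \<le> Y p} (p, t) \<partial>M) \<partial>lborel)"
    by (simp only: em)
  also have "\<dots> = (\<integral>\<^sup>+p. (\<integral>\<^sup>+t. indicator {(p, t). X p \<le> t \<and> t \<le> Y p} (p, t) \<partial>lborel) \<partial>M)"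
    by (rule P.Fubini') simp
  also have "\<dots> = (\<integral>\<^sup>+p. ennreal (max 0 (Y p - X p)) \<partial>M)"
  proof (rule nn_integral_cong)
    fix p
    have "(\<integral>\<^sup>+t. indicator {(p, t). X p \<le> t \<and> t \<le> Y p} (p, t) \<partial>lborel) =
        (\<integral>\<^sup>+t. indicator {X p..Y p} t \<partial>lborel)"
      by (intro nn_integral_cong) (auto simp: indicator_def)
    also have "\<dots> = ennreal (max 0 (Y p - X p))"
      by (cases "X p \<le> Y p") (auto simp: max_def)
    finally show "(\<integral>\<^sup>+t. indicator {(p, t). X p \<le> t \<and> t \<le> Y p} (p, t) \<partial>lborel) = ennreal (max 0 (Y p - X p))" .
  qed
  also have "\<dots> = ennreal (expectation (\<lambda>p. max 0 (Y p - X p)))"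
    by (intro nn_integral_eq_integral int) auto
  finally have nn: "(\<integral>\<^sup>+t. ennreal (?f t) \<partial>lborel) = ennreal (expectation (\<lambda>p. max 0 (Y p - X p)))" .
  have "(?f has_integral expectation (\<lambda>p. max 0 (Y p - X p))) UNIV"
  proof (rule nn_integral_has_integral[OF _ _ nn])
    have "(\<lambda>t. ennreal (?f t)) \<in> borel_measurable borel"
      unfolding em by measurable
    then have "(\<lambda>t. enn2real (ennreal (?f t))) \<in> borel_measurable borel"
      by measurable
    then show "?f \<in> borel_measurable borel" by simp
  qed simp_all
  moreover have "(\<lambda>t. if t \<in> {0..1} then ?f t else 0) = ?f"
  proof
    fix t
    show "(if t \<in> {0..1} then ?f t else 0) = ?f t"
    proof (cases "t \<in> {0..1}")
      case False
      have "\<not> (X p \<le> t \<and> t \<le> Y p)" if "p \<in> space M" for p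
        using False bounds[OF that] by (simp, linarith)
      then have "{p \<in> space M. X p \<le> t \<and> t \<le> Y p} = {}"
        by blast
      then show ?thesis using False by (metis measure_empty)
    qed simp
  qed
  ultimately have "((\<lambda>t. if t \<in> {0..1} then ?f t else 0) has_integral expectation (\<lambda>p. max 0 (Y p - X p))) UNIV"
    by (simp only:)
  then show ?thesis
    by (simp only: has_integral_restrict_UNIV)
qed

locale represented_copula = prob_space M for M :: "(real \<times> real) measure" +
  fixes C :: "real \<Rightarrow> real \<Rightarrow> real"
  assumes copula: "copula C" and rep: "represents M C"
begin

lemma sets_M: "sets M = sets square_borel"
  using rep by (simp add: represents_def)

lemma space_M: "space M = unit_square"
  using sets_eq_imp_space_eq[OF sets_M] by (simp add: space_restrict_space)

lemma measurable_square:
  assumes "f \<in> measurable borel N"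
  shows "f \<in> measurable M N"
  using measurable_restrict_space1[OF assms] sets_M by (simp cong: measurable_cong_sets)

lemma measurable_fst_M [measurable]: "fst \<in> borel_measurable M"
  and measurable_snd_M [measurable]: "snd \<in> borel_measurable M"
  by (rule measurable_square, rule borel_measurable_continuous_onI, intro continuous_intros)+

lemma prob_rect:
  assumes "u \<in> {0..1}" "v \<in> {0..1}"
  shows "prob {p \<in> space M. fst p \<le> u \<and> snd p \<le> v} = C u v"
proof -
  have "{p \<in> space M. fst p \<le> u \<and> snd p \<le> v} = {0..u} \<times> {0..v}"
    using assms unfolding space_M set_eq_iff mem_Collect_eq mem_Times_iff atLeastAtMost_iff by auto
  then show ?thesis using rep assms by (simp add: represents_def)
qed

lemma distr_fst: "distr M borel fst = unif"
  and distr_snd: "distr M borel snd = unif"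
proof -
  have *: "prob {p \<in> space M. fst p \<le> x} = clamp01 x \<and> prob {p \<in> space M. snd p \<le> x} = clamp01 x" for x
  proof (cases "x < 0")
    case True
    then have "{p \<in> space M. fst p \<le> x} = {}" "{p \<in> space M. snd p \<le> x} = {}"
      unfolding space_M set_eq_iff mem_Collect_eq mem_Times_iff atLeastAtMost_iff by auto
    then show ?thesis
      using True unfolding clamp01_def by (simp only: measure_empty) simp
  next
    case False
    then have "{p \<in> space M. fst p \<le> x} = {p \<in> space M. fst p \<le> clamp01 x \<and> snd p \<le> 1}"
      "{p \<in> space M. snd p \<le> x} = {p \<in> space M. fst p \<le> 1 \<and> snd p \<le> clamp01 x}"
      unfolding space_M set_eq_iff mem_Collect_eq mem_Times_iff atLeastAtMost_iff clamp01_def by auto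
    then show ?thesis
      by (simp only: prob_rect clamp01_simps copula_1_left[OF copula] copula_1_right[OF copula]
        atLeastAtMost_iff zero_le_one order_refl simp_thms)
  qed
  have "prob (fst -` {..x} \<inter> space M) = clamp01 x" "prob (snd -` {..x} \<inter> space M) = clamp01 x" for x
    using *[of x] by (simp_all only: vimage_def Int_def conj_commute mem_Collect_eq atMost_iff)
  then have "cdf (distr M borel fst) = cdf unif" "cdf (distr M borel snd) = cdf unif"
    by (simp_all add: fun_eq_iff cdf_unif[unfolded cdf_def] cdf_def measure_distr)
  moreover have "finite_borel_measure (distr M borel fst)" "finite_borel_measure (distr M borel snd)"
    by (simp_all add: real_distribution.finite_borel_measure_M)
  ultimately show "distr M borel fst = unif" "distr M borel snd = unif"
    by (simp_all add: cdf_unique' finite_borel_measure_unif)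
qed

lemma integrable_cont:
  fixes g :: "real \<times> real \<Rightarrow> real"
  assumes "continuous_on unit_square g"
  shows "integrable M g"
proof -
  have "compact (g ` unit_square)"
    by (intro compact_continuous_image assms compact_Times) auto
  then obtain B where "\<And>p. p \<in> unit_square \<Longrightarrow> norm (g p) \<le> B"
    unfolding bounded_iff using compact_imp_bounded bounded_iff by (metis imageI)
  moreover have "g \<in> borel_measurable M"
    using borel_measurable_continuous_on_restrict[OF assms] sets_M
    by (simp cong: measurable_cong_sets)
  ultimately show ?thesis
    by (intro integrable_const_bound[where B = B]) (auto simp: space_M intro!: AE_I2)
qed

lemma expectation_marginal:
  fixes g :: "real \<Rightarrow> real"
  assumes g: "continuous_on {0..1} g"
  shows "expectation (\<lambda>p. g (fst p)) = integral {0..1} g"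
    and "expectation (\<lambda>p. g (snd p)) = integral {0..1} g"
proof -
  define G where "G x = indicator {0..1} x * g x" for x
  have G [measurable]: "G \<in> borel_measurable borel"
    using borel_measurable_continuous_on_indicator[OF _ g] unfolding G_def by simp
  have "integral\<^sup>L unif G = integral\<^sup>L lborel (\<lambda>x. indicator {0..1} x *\<^sub>R G x)"
    unfolding unif_def
    by (subst integral_density[symmetric]) (auto simp: indicator_def ennreal_indicator intro!: density_cong arg_cong2[where f = "integral\<^sup>L"])
  also have "\<dots> = set_lebesgue_integral lborel {0..1} g"
    unfolding set_lebesgue_integral_def by (intro Bochner_Integration.integral_cong) (auto simp: G_def indicator_def)
  also have "\<dots> = integral {0..1} g"
    by (intro set_borel_integral_eq_integral borel_integrable_atLeastAtMost' g)
  finally have I: "integral\<^sup>L unif G = integral {0..1} g" .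
  have "expectation (\<lambda>p. g (fst p)) = expectation (\<lambda>p. G (fst p))"
    by (intro Bochner_Integration.integral_cong) (auto simp: G_def space_M)
  also have "\<dots> = integral\<^sup>L (distr M borel fst) G"
    by (subst integral_distr) auto
  finally show "expectation (\<lambda>p. g (fst p)) = integral {0..1} g"
    by (simp add: distr_fst I)
  have "expectation (\<lambda>p. g (snd p)) = expectation (\<lambda>p. G (snd p))"
    by (intro Bochner_Integration.integral_cong) (auto simp: G_def space_M)
  also have "\<dots> = integral\<^sup>L (distr M borel snd) G"
    by (subst integral_distr) auto
  finally show "expectation (\<lambda>p. g (snd p)) = integral {0..1} g"
    by (simp add: distr_snd I)
qed

lemma expectation_fst: "expectation fst = 1 / 2"
  and expectation_snd: "expectation snd = 1 / 2"
proof -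
  have "integral {0..1} (\<lambda>x::real. x) = 1 / 2"
    using ident_has_integral[of 0 "1::real"] by (simp add: integral_unique)
  then show "expectation fst = 1 / 2" "expectation snd = 1 / 2"
    using expectation_marginal[of "\<lambda>x. x"] by simp_all
qed

text \<open>\<open>C t t\<close> is the probability that the larger coordinate is at most
  \<open>t\<close>, so the integral is the mean of one minus the maximum. Maximum and minimum add up
  to \<open>fst p + snd p\<close>, which has mean 1.\<close>

lemma integral_diagonal: "integral {0..1} (\<lambda>t. C t t) = expectation (\<lambda>p. min (fst p) (snd p))"
proof -
  have "((\<lambda>t. prob {p \<in> space M. max (fst p) (snd p) \<le> t \<and> t \<le> 1}) has_integral
      expectation (\<lambda>p. max 0 (1 - max (fst p) (snd p)))) {0..1}"
    by (rule has_integral_prob_between) (auto simp: space_M)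
  moreover have "prob {p \<in> space M. max (fst p) (snd p) \<le> t \<and> t \<le> 1} = C t t" if "t \<in> {0..1}" for t
    using that prob_rect[of t t] by simp
  ultimately have "((\<lambda>t. C t t) has_integral expectation (\<lambda>p. max 0 (1 - max (fst p) (snd p)))) {0..1}"
    using has_integral_cong by (metis (no_types, lifting))
  then have "integral {0..1} (\<lambda>t. C t t) = expectation (\<lambda>p. max 0 (1 - max (fst p) (snd p)))"
    by (rule integral_unique)
  also have "\<dots> = expectation (\<lambda>p. 1 - fst p - snd p + min (fst p) (snd p))"
    by (intro Bochner_Integration.integral_cong) (auto simp: space_M max_def min_def)
  also have "\<dots> = 1 - expectation fst - expectation snd + expectation (\<lambda>p. min (fst p) (snd p))"
    by (simp add: integrable_cont continuous_intros prob_space)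
  finally show ?thesis by (simp add: expectation_fst expectation_snd)
qed

text \<open>\<open>C t (1 - t)\<close> is the probability that \<open>t\<close> lies between
  \<open>fst p\<close> and \<open>1 - snd p\<close>. The positive and negative parts of
  \<open>fst p + snd p - 1\<close> have equal means because that variable has mean 0.\<close>

lemma integral_antidiagonal:
  "integral {0..1} (\<lambda>t. C t (1 - t)) = expectation (\<lambda>p. max 0 (fst p + snd p - 1))"
proof -
  have "((\<lambda>t. prob {p \<in> space M. fst p \<le> t \<and> t \<le> 1 - snd p}) has_integral
      expectation (\<lambda>p. max 0 (1 - snd p - fst p))) {0..1}"
    by (rule has_integral_prob_between) (auto simp: space_M)
  moreover have "prob {p \<in> space M. fst p \<le> t \<and> t \<le> 1 - snd p} = C t (1 - t)" if "t \<in> {0..1}" for t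
  proof -
    have "{p \<in> space M. fst p \<le> t \<and> t \<le> 1 - snd p} = {p \<in> space M. fst p \<le> t \<and> snd p \<le> 1 - t}"
      by (intro Collect_cong) linarith
    then show ?thesis using that prob_rect[of t "1 - t"] by simp
  qed
  ultimately have "((\<lambda>t. C t (1 - t)) has_integral expectation (\<lambda>p. max 0 (1 - snd p - fst p))) {0..1}"
    using has_integral_cong by (metis (no_types, lifting))
  then have "integral {0..1} (\<lambda>t. C t (1 - t)) = expectation (\<lambda>p. max 0 (1 - snd p - fst p))"
    by (rule integral_unique)
  also have "\<dots> = expectation (\<lambda>p. 1 - fst p - snd p + max 0 (fst p + snd p - 1))"
    by (intro Bochner_Integration.integral_cong) (auto simp: max_def)
  also have "\<dots> = 1 - expectation fst - expectation snd + expectation (\<lambda>p. max 0 (fst p + snd p - 1))"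
    by (simp add: integrable_cont continuous_intros prob_space)
  finally show ?thesis by (simp add: expectation_fst expectation_snd)
qed

lemma expectation_mono_square:
  assumes "continuous_on unit_square f" "continuous_on unit_square g"
    and "\<And>u v. u \<in> {0..1} \<Longrightarrow> v \<in> {0..1} \<Longrightarrow> f (u, v) \<le> g (u, v)"
  shows "expectation f \<le> (expectation g :: real)"
  using assms by (intro integral_mono integrable_cont) (auto simp: space_M)

lemma continuous_on_copula:
  assumes "continuous_on S f" "continuous_on S g" "f ` S \<subseteq> {0..1}" "g ` S \<subseteq> {0..1}"
  shows "continuous_on S (\<lambda>p. C (f p) (g p))"
proof -
  have "continuous_on S (\<lambda>p. (f p, g p))"
    using assms by (intro continuous_on_Pair)
  moreover have "(\<lambda>p. (f p, g p)) ` S \<subseteq> unit_square"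
    using assms by auto
  ultimately show ?thesis
    using continuous_on_compose2[OF copula_continuous_on[OF copula], of S "\<lambda>p. (f p, g p)"] by simp
qed

text \<open>Truncation at the median: the smaller truncated coordinate is at most
  \<open>min u v\<close> and the larger at most 1/2. Each truncated coordinate has mean 3/8.\<close>

lemma diagonal_lower: "1 / 4 \<le> integral {0..1} (\<lambda>t. C t t)"
proof -
  have "((\<lambda>x::real. min x (1/2)) has_integral (1/8 + 1/4)) {0..1}"
  proof (rule has_integral_combine[of 0 "1/2" 1])
    show "((\<lambda>x::real. min x (1/2)) has_integral 1/8) {0..1/2}"
      by (rule has_integral_affine_piece[where m = 1 and c = 0]) (auto simp: power2_eq_square)
    show "((\<lambda>x::real. min x (1/2)) has_integral 1/4) {1/2..1}"
      by (rule has_integral_affine_piece[where m = 0 and c = "1/2"]) auto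
  qed simp_all
  then have "integral {0..1} (\<lambda>x::real. min x (1/2)) = 3 / 8"
    by (simp add: integral_unique)
  then have "expectation (\<lambda>p. min (fst p) (1/2)) = 3 / 8" "expectation (\<lambda>p. min (snd p) (1/2)) = 3 / 8"
    using expectation_marginal[of "\<lambda>x. min x (1/2)"] by (simp_all add: continuous_intros)
  then have "1 / 4 = expectation (\<lambda>p. min (fst p) (1/2) + min (snd p) (1/2) - 1/2)"
    by (simp add: integrable_cont continuous_intros prob_space)
  also have "\<dots> \<le> expectation (\<lambda>p. min (fst p) (snd p))"
    by (intro expectation_mono_square continuous_intros) (auto simp: min_def)
  finally show ?thesis by (simp add: integral_diagonal)
qed

text \<open>The positive part is subadditive; it is applied to \<open>u - 1/2\<close> and
  \<open>v - 1/2\<close>, whose positive parts have mean 1/8 each.\<close>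

lemma antidiagonal_upper: "integral {0..1} (\<lambda>t. C t (1 - t)) \<le> 1 / 4"
proof -
  have "((\<lambda>x::real. max 0 (x - 1/2)) has_integral (0 + 1/8)) {0..1}"
  proof (rule has_integral_combine[of 0 "1/2" 1])
    show "((\<lambda>x::real. max 0 (x - 1/2)) has_integral 0) {0..1/2}"
      by (rule has_integral_affine_piece[where m = 0 and c = 0]) auto
    show "((\<lambda>x::real. max 0 (x - 1/2)) has_integral 1/8) {1/2..1}"
      by (rule has_integral_affine_piece[where m = 1 and c = "-1/2"]) (auto simp: power2_eq_square)
  qed simp_all
  then have "integral {0..1} (\<lambda>x::real. max 0 (x - 1/2)) = 1 / 8"
    by (simp add: integral_unique)
  then have "expectation (\<lambda>p. max 0 (fst p - 1/2)) = 1 / 8" "expectation (\<lambda>p. max 0 (snd p - 1/2)) = 1 / 8"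
    using expectation_marginal[of "\<lambda>x. max 0 (x - 1/2)"] by (simp_all add: continuous_intros)
  then have "expectation (\<lambda>p. max 0 (fst p - 1/2) + max 0 (snd p - 1/2)) = 1 / 4"
    by (simp add: integrable_cont continuous_intros prob_space)
  moreover have "expectation (\<lambda>p. max 0 (fst p + snd p - 1)) \<le>
      expectation (\<lambda>p. max 0 (fst p - 1/2) + max 0 (snd p - 1/2))"
    by (intro expectation_mono_square continuous_intros) (auto simp: max_def)
  ultimately show ?thesis by (simp add: integral_antidiagonal)
qed

text \<open>The pointwise estimate is the dual of the optimal transport problem that minimises
  the expectation of \<open>min (k U) (k V)\<close>, where \<open>k u = min u (1 - u)\<close> is uniform on
  \<open>[0, 1/2]\<close>.\<close>

lemma antidiagonal_diagonal:
  "integral {0..1} (\<lambda>t. C t (1 - t)) \<le> integral {0..1} (\<lambda>t. C t t) - 1 / 8"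
proof -
  let ?k = "\<lambda>x::real. min (min x (1 - x)) (1/4)"
  have "(?k has_integral (1/32 + (1/8 + 1/32))) {0..1}"
  proof (rule has_integral_combine[of 0 "1/4" 1])
    show "(?k has_integral 1/32) {0..1/4}"
      by (rule has_integral_affine_piece[where m = 1 and c = 0]) (auto simp: power2_eq_square)
    show "(?k has_integral (1/8 + 1/32)) {1/4..1}"
    proof (rule has_integral_combine[of "1/4" "3/4" 1])
      show "(?k has_integral 1/8) {1/4..3/4}"
        by (rule has_integral_affine_piece[where m = 0 and c = "1/4"]) auto
      show "(?k has_integral 1/32) {3/4..1}"
        by (rule has_integral_affine_piece[where m = "-1" and c = 1]) (auto simp: power2_eq_square)
    qed simp_all
  qed simp_all
  then have "integral {0..1} ?k = 3 / 16"
    by (simp add: integral_unique)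
  then have "expectation (\<lambda>p. ?k (fst p)) = 3 / 16" "expectation (\<lambda>p. ?k (snd p)) = 3 / 16"
    using expectation_marginal[of ?k] by (simp_all add: continuous_intros)
  then have "1 / 8 = expectation (\<lambda>p. ?k (fst p) + ?k (snd p) - 1/4)"
    by (simp add: integrable_cont continuous_intros prob_space)
  \<comment> \<open>The right integrand is the minimum of \<open>min u (1 - u)\<close> and
    \<open>min v (1 - v)\<close>. As in \<open>diagonal_lower\<close>, it is bounded below by
    truncation at the median, here 1/4.\<close>
  also have "\<dots> \<le> expectation (\<lambda>p. min (fst p) (snd p) - max 0 (fst p + snd p - 1))"
    by (intro expectation_mono_square continuous_intros) (auto simp: min_def max_def)
  also have "\<dots> = expectation (\<lambda>p. min (fst p) (snd p)) - expectation (\<lambda>p. max 0 (fst p + snd p - 1))"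
    by (simp add: integrable_cont continuous_intros)
  finally show ?thesis by (simp add: integral_diagonal integral_antidiagonal)
qed

section \<open>Bounds on the integral of a copula against its own measure\<close>

abbreviation "T \<equiv> expectation (\<lambda>p. C (fst p) (snd p))"

lemma T_upper_diagonal: "T \<le> integral {0..1} (\<lambda>t. C t t)"
  unfolding integral_diagonal
proof (intro expectation_mono_square continuous_on_copula continuous_intros)
  fix u v :: real assume "u \<in> {0..1}" "v \<in> {0..1}"
  then show "C (fst (u, v)) (snd (u, v)) \<le> min (fst (u, v)) (snd (u, v))"
    using copula_increment_left[OF copula, of 0 u v] copula_increment_right[OF copula, of 0 v u]
    by (simp add: copula_0_left[OF copula] copula_0_right[OF copula])
qed auto

lemma T_lower_antidiagonal: "integral {0..1} (\<lambda>t. C t (1 - t)) \<le> T"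
  unfolding integral_antidiagonal
proof (intro expectation_mono_square continuous_on_copula continuous_intros)
  fix u v :: real assume "u \<in> {0..1}" "v \<in> {0..1}"
  then show "max 0 (fst (u, v) + snd (u, v) - 1) \<le> C (fst (u, v)) (snd (u, v))"
    using copula_increment_left[OF copula, of 0 u v] copula_increment_left[OF copula, of u 1 v]
    by (simp add: copula_0_left[OF copula] copula_1_left[OF copula])
qed auto

text \<open>Moving the second argument from \<open>u\<close> to \<open>v\<close> lowers
  \<open>C\<close> by at most \<open>max 0 (u - v)\<close>. Since \<open>fst\<close> is uniform, the
  mean of \<open>C\<close> at \<open>(u, u)\<close> is the diagonal integral.\<close>

lemma T_lower_diagonal: "2 * integral {0..1} (\<lambda>t. C t t) - 1 / 2 \<le> T"
proof -
  have cont: "continuous_on {0..1} (\<lambda>t. C t t)"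
    by (intro continuous_on_copula continuous_intros) auto
  have "2 * integral {0..1} (\<lambda>t. C t t) - 1 / 2 =
      expectation (\<lambda>p. C (fst p) (fst p)) - (expectation fst - expectation (\<lambda>p. min (fst p) (snd p)))"
    by (simp add: integral_diagonal[symmetric] expectation_marginal(1)[OF cont] expectation_fst)
  also have "\<dots> = expectation (\<lambda>p. C (fst p) (fst p) - (fst p - min (fst p) (snd p)))"
    by (subst Bochner_Integration.integral_diff Bochner_Integration.integral_diff[of M fst],
      auto intro!: integrable_cont continuous_on_copula continuous_intros)+
  also have "\<dots> \<le> T"
  proof (intro expectation_mono_square continuous_on_copula continuous_intros)
    fix u v :: real assume "u \<in> {0..1}" "v \<in> {0..1}"
    then show "C (fst (u, v)) (fst (u, v)) - (fst (u, v) - min (fst (u, v)) (snd (u, v))) \<le> C (fst (u, v)) (snd (u, v))"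
      using copula_increment_right[OF copula, of u v u] copula_increment_right[OF copula, of v u u]
      by (auto simp: min_def)
  qed auto
  finally show ?thesis .
qed

text \<open>Moving the second argument from \<open>1 - u\<close> to \<open>v\<close> raises
  \<open>C\<close> by at most \<open>max 0 (u + v - 1)\<close>. Both resulting terms have the
  antidiagonal integral as their mean.\<close>

lemma T_upper_antidiagonal: "T \<le> 2 * integral {0..1} (\<lambda>t. C t (1 - t))"
proof -
  have cont: "continuous_on {0..1} (\<lambda>t. C t (1 - t))"
    by (intro continuous_on_copula continuous_intros) auto
  have "T \<le> expectation (\<lambda>p. C (fst p) (1 - fst p) + max 0 (fst p + snd p - 1))"
  proof (intro expectation_mono_square continuous_on_copula continuous_intros)
    fix u v :: real assume "u \<in> {0..1}" "v \<in> {0..1}"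
    then show "C (fst (u, v)) (snd (u, v)) \<le> C (fst (u, v)) (1 - fst (u, v)) + max 0 (fst (u, v) + snd (u, v) - 1)"
      using copula_increment_right[OF copula, of "1 - u" v u] copula_increment_right[OF copula, of v "1 - u" u]
      by (auto simp: max_def)
  qed auto
  also have "\<dots> = expectation (\<lambda>p. C (fst p) (1 - fst p)) + expectation (\<lambda>p. max 0 (fst p + snd p - 1))"
    by (intro Bochner_Integration.integral_add integrable_cont continuous_on_copula continuous_intros) auto
  also have "\<dots> = 2 * integral {0..1} (\<lambda>t. C t (1 - t))"
    by (simp add: integral_antidiagonal[symmetric] expectation_marginal(1)[OF cont])
  finally show ?thesis .
qed

end

lemma represented_copulaI: "copula C \<Longrightarrow> represents M C \<Longrightarrow> represented_copula M C"
  by (simp add: represented_copula_def represented_copula_axioms_def represents_def)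

lemma region_subset_polyhedron: "footrule_gamma_tau_region \<subseteq> footrule_gamma_tau_polyhedron"
proof -
  have "(spearman_footrule C, gini_gamma C, kendall_tau C) \<in> footrule_gamma_tau_polyhedron"
    if "copula C" for C
  proof -
    obtain M where M: "represents M C"
      using copula_represented[OF \<open>copula C\<close>] by blast
    interpret represented_copula M C
      by (rule represented_copulaI) fact+
    show ?thesis
      unfolding footrule_gamma_tau_polyhedron_def spearman_footrule_def gini_gamma_def kendall_tau_def
        copula_measure_eqI[OF M]
      \<comment> \<open>With \<open>\<phi> = 6 * A - 2\<close>,
        \<open>\<gamma> = 4 * A + 4 * B - 2\<close> and \<open>\<tau> = 4 * T - 1\<close>, the seven
        bounds correspond one to one to the seven inequalities.\<close>
      using diagonal_lower antidiagonal_upper antidiagonal_diagonal T_upper_diagonal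
        T_lower_antidiagonal T_lower_diagonal T_upper_antidiagonal
      by simp
  qed
  then show ?thesis
    by (auto simp: footrule_gamma_tau_region_def)
qed

subsection \<open>Reflection and mixing\<close>

lemma copula_nonneg: "copula C \<Longrightarrow> u \<in> {0..1} \<Longrightarrow> v \<in> {0..1} \<Longrightarrow> 0 \<le> C u v"
  unfolding copula_def by (meson atLeastAtMost_iff)

text \<open>The measure is part of the witness, so that constructions can work with explicit
  measures; \<open>copula_measure\<close> returns only in the final theorem.\<close>

definition attains :: "real \<Rightarrow> real \<Rightarrow> real \<Rightarrow> bool" where
  "attains A B T \<longleftrightarrow> (\<exists>M C. copula C \<and> represents M C \<and> integral {0..1} (\<lambda>t. C t t) = A \<and>
     integral {0..1} (\<lambda>t. C t (1 - t)) = B \<and> (\<integral>p. C (fst p) (snd p) \<partial>M) = T)"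

context represented_copula
begin

lemma prob_snd_eq: "prob {p \<in> space M. snd p = c} = 0"
proof -
  have "prob {p \<in> space M. snd p = c} = measure (distr M borel snd) {c}"
    by (subst measure_distr) (auto simp: vimage_def Int_def conj_commute)
  also have "\<dots> = 0"
    unfolding distr_snd by (simp add: measure_def emeasure_unif emeasure_lborel_countable)
  finally show ?thesis .
qed

lemma prob_fst_le:
  assumes "u \<in> {0..1}"
  shows "prob {p \<in> space M. fst p \<le> u} = u"
proof -
  have "{p \<in> space M. fst p \<le> u} = {p \<in> space M. fst p \<le> u \<and> snd p \<le> 1}"
    unfolding space_M set_eq_iff mem_Collect_eq mem_Times_iff atLeastAtMost_iff by auto
  then show ?thesis
    using assms by (simp add: prob_rect copula_1_right[OF copula])
qed

lemma reflection_measurable: "(\<lambda>p. (fst p, 1 - snd p)) \<in> measurable M square_borel"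
proof (rule measurable_restrict_space2)
  show "(\<lambda>p. (fst p, 1 - snd p)) \<in> measurable M borel"
    unfolding borel_prod[symmetric] by measurable
qed (auto simp: space_M)

lemma reflected_represents:
  "represents (distr M square_borel (\<lambda>p. (fst p, 1 - snd p))) (\<lambda>u v. u - C u (1 - v))"
proof -
  show ?thesis
    unfolding represents_def
  proof (intro conjI ballI)
    fix u v :: real assume u: "u \<in> {0..1}" and v: "v \<in> {0..1}"
    let ?A = "{p \<in> space M. fst p \<le> u}" and ?B = "{p \<in> space M. fst p \<le> u \<and> snd p \<le> 1 - v}"
    have "measure (distr M square_borel (\<lambda>p. (fst p, 1 - snd p))) ({0..u} \<times> {0..v})
        = prob ((\<lambda>p. (fst p, 1 - snd p)) -` ({0..u} \<times> {0..v}) \<inter> space M)"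
      using u v by (subst measure_distr[OF reflection_measurable rect_in_square_borel]) auto
    \<comment> \<open>The preimage is the closed region \<open>snd p \<ge> 1 - v\<close>, which
      overlaps \<open>?B\<close> in a horizontal line. That line is null because the second margin
      is uniform.\<close>
    also have "(\<lambda>p. (fst p, 1 - snd p)) -` ({0..u} \<times> {0..v}) \<inter> space M =
        (?A - ?B) \<union> {p \<in> space M. fst p \<le> u \<and> snd p = 1 - v}" (is "_ = _ \<union> ?N")
      unfolding space_M using u v by auto
    also have "prob \<dots> = prob (?A - ?B)"
    proof (rule measure_Un_null_set)
      have "prob ?N \<le> prob {p \<in> space M. snd p = 1 - v}"
        by (rule finite_measure_mono) auto
      then have "prob ?N = 0"
        using prob_snd_eq[of "1 - v"] measure_nonneg[of M ?N] by linarith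
      then show "?N \<in> null_sets M"
        by (auto simp: null_sets_def emeasure_eq_measure)
    qed auto
    also have "\<dots> = prob ?A - prob ?B"
      by (rule finite_measure_Diff) auto
    also have "\<dots> = u - C u (1 - v)"
      using u v by (simp add: prob_fst_le prob_rect)
    finally show "measure (distr M square_borel (\<lambda>p. (fst p, 1 - snd p))) ({0..u} \<times> {0..v}) = u - C u (1 - v)" .
  qed (use prob_space_distr[OF reflection_measurable] in auto)
qed

text \<open>Reflection exchanges the two diagonals. Along the reflected pair, the new copula takes
  the value \<open>fst p - C (fst p) (snd p)\<close>, whose mean is \<open>1/2 - T\<close>.\<close>

lemma reflected_attains:
  "attains (1 / 2 - integral {0..1} (\<lambda>t. C t (1 - t))) (1 / 2 - integral {0..1} (\<lambda>t. C t t)) (1 / 2 - T)"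
proof -
  let ?C = "\<lambda>u v. u - C u (1 - v)" and ?M = "distr M square_borel (\<lambda>p. (fst p, 1 - snd p))"
  have rep: "represents ?M ?C"
    by (rule reflected_represents)
  have cop: "copula ?C"
    by (rule represents_copula[OF rep]) (simp_all add: copula_0_right[OF copula] copula_1_left[OF copula])
  interpret R: represented_copula ?M ?C
    by (rule represented_copulaI[OF cop rep])
  have id: "((\<lambda>x::real. x) has_integral 1/2) {0..1}"
    using ident_has_integral[of 0 "1::real"] by simp
  have int: "(\<lambda>t. C t (1 - t)) integrable_on {0..1}" "(\<lambda>t. C t t) integrable_on {0..1}"
    by (intro integrable_continuous_real continuous_on_copula continuous_intros; auto)+
  have "integral {0..1} (\<lambda>t. ?C t t) = 1 / 2 - integral {0..1} (\<lambda>t. C t (1 - t))"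
    by (intro integral_unique has_integral_diff id integrable_integral int)
  moreover have "integral {0..1} (\<lambda>t. ?C t (1 - t)) = 1 / 2 - integral {0..1} (\<lambda>t. C t t)"
    by simp (intro integral_unique has_integral_diff id integrable_integral int)
  moreover have "R.T = 1 / 2 - T"
  proof -
    have "(\<lambda>p. ?C (fst p) (snd p)) \<in> borel_measurable square_borel"
      by (rule borel_measurable_continuous_on_restrict[OF copula_continuous_on[OF cop]])
    then have "R.T = expectation (\<lambda>p. fst p - C (fst p) (snd p))"
      by (subst integral_distr[OF reflection_measurable]) simp_all
    also have "\<dots> = 1 / 2 - T"
      by (subst Bochner_Integration.integral_diff)
        (auto intro!: integrable_cont continuous_on_copula continuous_intros simp: expectation_fst)
    finally show ?thesis .
  qed
  ultimately show ?thesis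
    unfolding attains_def using cop rep by blast
qed

end

lemma attains_reflect: "attains A B T \<Longrightarrow> attains (1 / 2 - B) (1 / 2 - A) (1 / 2 - T)"
  unfolding attains_def[of A B T] using represented_copula.reflected_attains represented_copulaI by blast

lemma attains_mix:
  assumes "attains A B t0" "attains A B t1" "t0 \<le> t" "t \<le> t1"
  shows "attains A B t"
proof -
  obtain M0 C0 where 0: "copula C0" "represents M0 C0" "integral {0..1} (\<lambda>t. C0 t t) = A"
     "integral {0..1} (\<lambda>t. C0 t (1 - t)) = B" "(\<integral>p. C0 (fst p) (snd p) \<partial>M0) = t0"
    using assms(1) unfolding attains_def by blast
  obtain M1 C1 where 1: "copula C1" "represents M1 C1" "integral {0..1} (\<lambda>t. C1 t t) = A"
     "integral {0..1} (\<lambda>t. C1 t (1 - t)) = B" "(\<integral>p. C1 (fst p) (snd p) \<partial>M1) = t1"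
    using assms(2) unfolding attains_def by blast
  interpret M0: represented_copula M0 C0 by (rule represented_copulaI) fact+
  interpret M1: represented_copula M1 C1 by (rule represented_copulaI) fact+
  \<comment> \<open>The cross terms of the bilinear pairing of copula and measure. Their values are
    irrelevant: \<open>\<tau>\<close> is a polynomial with the required end values, and continuity
    suffices.\<close>
  define x01 where "x01 = (\<integral>p. C1 (fst p) (snd p) \<partial>M0)"
  define x10 where "x10 = (\<integral>p. C0 (fst p) (snd p) \<partial>M1)"
  define \<tau> where "\<tau> s = s * (s * t1 + (1 - s) * x10) + (1 - s) * (s * x01 + (1 - s) * t0)" for s :: real
  have "continuous_on {0..1} \<tau>"
    unfolding \<tau>_def by (intro continuous_intros)
  moreover have "\<tau> 0 = t0" "\<tau> 1 = t1"
    by (simp_all add: \<tau>_def)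
  ultimately obtain s where s: "0 \<le> s" "s \<le> 1" "\<tau> s = t"
    using IVT'[of \<tau> 0 t 1] assms(3,4) by auto
  define C where "C u v = s * C1 u v + (1 - s) * C0 u v" for u v
  \<comment> \<open>The mixture as a two-stage experiment: a coin with success probability
    \<open>s\<close> selects \<open>M1\<close> or \<open>M0\<close>.\<close>
  define M where "M = measure_pmf (bernoulli_pmf s) \<bind> (\<lambda>b. if b then M1 else M0)"
  have K: "(\<lambda>b. if b then M1 else M0) \<in> measurable (measure_pmf (bernoulli_pmf s)) (subprob_algebra square_borel)"
    using M0.sets_M M1.sets_M
    by (auto simp: measurable_pmf_measure1 space_subprob_algebra M0.subprob_space_axioms M1.subprob_space_axioms)
  have nn: "(\<integral>\<^sup>+p. f p \<partial>M) = s * (\<integral>\<^sup>+p. f p \<partial>M1) + (1 - s) * (\<integral>\<^sup>+p. f p \<partial>M0)"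
    if "f \<in> borel_measurable square_borel" for f
    unfolding M_def using s that by (subst nn_integral_bind[OF _ K]) (auto simp: mult.commute)
  have em: "emeasure M X = s * emeasure M1 X + (1 - s) * emeasure M0 X" if "X \<in> sets square_borel" for X
    unfolding M_def using s that by (subst emeasure_bind[OF _ K]) (auto simp: mult.commute)
  have sets_M: "sets M = sets square_borel"
    unfolding M_def by (rule sets_bind) (use M0.sets_M M1.sets_M in auto)
  have rep: "represents M C"
    unfolding represents_def
  proof (intro conjI ballI)
    show "prob_space M"
      unfolding M_def
      by (rule measure_pmf.prob_space_bind[OF _ K]) (auto simp: M0.prob_space_axioms M1.prob_space_axioms)
    fix u v :: real assume uv: "u \<in> {0..1}" "v \<in> {0..1}"
    have nonneg: "0 \<le> C0 u v" "0 \<le> C1 u v"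
      using copula_nonneg 0(1) 1(1) uv by blast+
    have "emeasure M ({0..u} \<times> {0..v}) = s * emeasure M1 ({0..u} \<times> {0..v}) + (1 - s) * emeasure M0 ({0..u} \<times> {0..v})"
      using uv by (intro em rect_in_square_borel) auto
    also have "\<dots> = ennreal s * ennreal (C1 u v) + ennreal (1 - s) * ennreal (C0 u v)"
      using uv 0(2) 1(2) by (simp add: M0.emeasure_eq_measure M1.emeasure_eq_measure represents_def)
    also have "\<dots> = ennreal (C u v)"
      using s nonneg by (simp add: C_def ennreal_mult ennreal_plus)
    finally have "emeasure M ({0..u} \<times> {0..v}) = ennreal (C u v)" .
    moreover have "0 \<le> C u v"
      using s nonneg by (simp add: C_def)
    ultimately show "measure M ({0..u} \<times> {0..v}) = C u v"
      by (simp only: measure_def enn2real_ennreal)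
  qed (rule sets_M)
  have cop: "copula C"
    by (rule represents_copula[OF rep])
      (simp_all add: C_def copula_1_left[OF 0(1)] copula_1_left[OF 1(1)] copula_1_right[OF 0(1)]
        copula_1_right[OF 1(1)] algebra_simps)
  interpret M: represented_copula M C by (rule represented_copulaI) fact+
  have int: "(\<lambda>t. C0 t (1 - t)) integrable_on {0..1}" "(\<lambda>t. C0 t t) integrable_on {0..1}"
     "(\<lambda>t. C1 t (1 - t)) integrable_on {0..1}" "(\<lambda>t. C1 t t) integrable_on {0..1}"
    by (intro integrable_continuous_real M0.continuous_on_copula M1.continuous_on_copula continuous_intros; auto)+
  have "((\<lambda>t. C1 t t) has_integral A) {0..1}" "((\<lambda>t. C0 t t) has_integral A) {0..1}"
    "((\<lambda>t. C1 t (1 - t)) has_integral B) {0..1}" "((\<lambda>t. C0 t (1 - t)) has_integral B) {0..1}"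
    using int[THEN integrable_integral] 0(3,4) 1(3,4) by simp_all
  then have "((\<lambda>t. C t t) has_integral s * A + (1 - s) * A) {0..1}"
    "((\<lambda>t. C t (1 - t)) has_integral s * B + (1 - s) * B) {0..1}"
    unfolding C_def by (intro has_integral_add has_integral_mult_right; simp)+
  then have AB: "integral {0..1} (\<lambda>t. C t t) = A" "integral {0..1} (\<lambda>t. C t (1 - t)) = B"
    by (simp_all add: integral_unique algebra_simps)
  \<comment> \<open>The mixture formula is available for nonnegative integrals, so it is transferred
    for nonnegative \<open>g\<close>; the integrand \<open>C\<close> to which it is applied is
    nonnegative.\<close>
  have lin: "M.expectation g = s * M1.expectation g + (1 - s) * M0.expectation g"
    if g: "continuous_on unit_square g" "\<And>p. p \<in> unit_square \<Longrightarrow> 0 \<le> g p" for g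
  proof -
    have "(\<integral>\<^sup>+p. ennreal (g p) \<partial>M) = ennreal (M.expectation g)"
      "(\<integral>\<^sup>+p. ennreal (g p) \<partial>M1) = ennreal (M1.expectation g)"
      "(\<integral>\<^sup>+p. ennreal (g p) \<partial>M0) = ennreal (M0.expectation g)"
      by (intro nn_integral_eq_integral M.integrable_cont M1.integrable_cont M0.integrable_cont g AE_I2;
        simp only: M.space_M M1.space_M M0.space_M g(2))+
    moreover have "g \<in> borel_measurable square_borel"
      by (intro borel_measurable_continuous_on_restrict g)
    then have "(\<integral>\<^sup>+p. ennreal (g p) \<partial>M) = s * (\<integral>\<^sup>+p. ennreal (g p) \<partial>M1) + (1 - s) * (\<integral>\<^sup>+p. ennreal (g p) \<partial>M0)"
      by (intro nn) measurable
    moreover have "0 \<le> M.expectation g" "0 \<le> M1.expectation g" "0 \<le> M0.expectation g"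
      by (intro Bochner_Integration.integral_nonneg_AE AE_I2; simp only: M.space_M M1.space_M M0.space_M g(2))+
    ultimately show ?thesis
      using s by (simp add: ennreal_mult[symmetric] ennreal_plus[symmetric] del: ennreal_plus)
  qed
  have cont: "continuous_on unit_square (\<lambda>p. C (fst p) (snd p))"
    by (rule copula_continuous_on[OF cop])
  have "M.T = s * M1.expectation (\<lambda>p. C (fst p) (snd p)) + (1 - s) * M0.expectation (\<lambda>p. C (fst p) (snd p))"
    by (rule lin[OF cont]) (auto intro: copula_nonneg[OF cop])
  also have "M1.expectation (\<lambda>p. C (fst p) (snd p)) = s * t1 + (1 - s) * x10"
    unfolding C_def x10_def 1(5)[symmetric]
    by (simp add: M1.integrable_cont copula_continuous_on 0 1)
  also have "M0.expectation (\<lambda>p. C (fst p) (snd p)) = s * x01 + (1 - s) * t0"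
    unfolding C_def x01_def 0(5)[symmetric]
    by (simp add: M0.integrable_cont copula_continuous_on 0 1)
  finally have "M.T = t"
    using s by (simp add: \<tau>_def)
  then show ?thesis
    unfolding attains_def using cop rep AB by blast
qed

subsection \<open>Copulas carried by a graph\<close>

lemma has_integral_unif:
  fixes h :: "real \<Rightarrow> real"
  assumes "integrable unif h"
  shows "(h has_integral integral\<^sup>L unif h) {0..1}"
proof -
  have [measurable]: "h \<in> borel_measurable borel"
    using borel_measurable_integrable[OF assms] by (simp cong: measurable_cong_sets)
  have unif: "unif = density lborel (\<lambda>x. ennreal (indicator {0..1} x))"
    by (simp add: unif_def ennreal_indicator)
  have "set_integrable lborel {0..1} h"
    using assms unfolding unif set_integrable_def by (subst (asm) integrable_density) auto
  then have "(h has_integral set_lebesgue_integral lborel {0..1} h) {0..1}"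
    using set_borel_integral_eq_integral by (metis integrable_integral)
  also have "set_lebesgue_integral lborel {0..1} h = integral\<^sup>L unif h"
    unfolding unif set_lebesgue_integral_def by (subst integral_density) auto
  finally show ?thesis .
qed

lemma measure_unif: "X \<in> sets borel \<Longrightarrow> measure unif X = measure lborel (X \<inter> {0..1})"
  by (simp add: measure_def emeasure_unif)

text \<open>\<open>uniform\<close> says that \<open>f\<close> carries the uniform distribution to
  itself, so the law of a uniform variable paired with its image under \<open>f\<close> has uniform
  margins.\<close>

locale shuffle =
  fixes f :: "real \<Rightarrow> real"
  assumes meas [measurable]: "f \<in> borel_measurable borel"
    and range: "x \<in> {0..1} \<Longrightarrow> f x \<in> {0..1}"
    and uniform: "v \<in> {0..1} \<Longrightarrow> ((\<lambda>x. if f x \<le> v then 1 else 0 :: real) has_integral v) {0..1}"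
begin

text \<open>Clamping sends every real argument to a graph point in the square; as
  \<open>unif\<close> lives on the unit interval, \<open>C_eq\<close> can remove it.\<close>

definition C :: "real \<Rightarrow> real \<Rightarrow> real" where
  "C u v = measure unif {x. clamp01 x \<le> u \<and> f (clamp01 x) \<le> v}"

definition M :: "(real \<times> real) measure" where
  "M = distr unif square_borel (\<lambda>x. (clamp01 x, f (clamp01 x)))"

lemma clamp01_measurable [measurable]: "clamp01 \<in> borel_measurable borel"
  unfolding clamp01_def by measurable

lemma graph_measurable: "(\<lambda>x. (clamp01 x, f (clamp01 x))) \<in> measurable unif square_borel"
proof (rule measurable_restrict_space2)
  show "(\<lambda>x. (clamp01 x, f (clamp01 x))) \<in> measurable unif borel"
    unfolding borel_prod[symmetric] by measurable
qed (use range in \<open>simp add: Pi_def\<close>)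

lemma C_eq: "C u v = measure lborel {x \<in> {0..1}. x \<le> u \<and> f x \<le> v}"
proof -
  have "{x \<in> space borel. clamp01 x \<le> u \<and> f (clamp01 x) \<le> v} \<in> sets borel"
    by measurable
  moreover have "{x. clamp01 x \<le> u \<and> f (clamp01 x) \<le> v} \<inter> {0..1} = {x \<in> {0..1}. x \<le> u \<and> f x \<le> v}"
    by (auto simp: clamp01_id)
  ultimately show ?thesis
    by (simp add: C_def measure_unif)
qed

lemma level_sets [measurable]: "{x \<in> {0..1}. x \<le> u \<and> f x \<le> v} \<in> sets borel" "{x \<in> {0..1}. f x \<le> v} \<in> sets borel"
proof -
  have "{x \<in> space borel. x \<in> {0..1} \<and> x \<le> u \<and> f x \<le> v} \<in> sets borel"
    "{x \<in> space borel. x \<in> {0..1} \<and> f x \<le> v} \<in> sets borel"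
    by measurable
  then show "{x \<in> {0..1}. x \<le> u \<and> f x \<le> v} \<in> sets borel" "{x \<in> {0..1}. f x \<le> v} \<in> sets borel"
    by simp_all
qed

lemma fmeasurable_unit_subset:
  "S \<in> sets borel \<Longrightarrow> S \<subseteq> {0..1} \<Longrightarrow> S \<in> fmeasurable (lborel :: real measure)"
  by (rule fmeasurableI2[of "{0..1}"]) (auto intro: fmeasurableI)

lemma level_measure:
  assumes "v \<in> {0..1}"
  shows "measure lborel {x \<in> {0..1}. f x \<le> v} = v"
proof -
  let ?S = "{x \<in> {0..1}. f x \<le> v}"
  have "((\<lambda>x. if x \<in> ?S then 1 else 0 :: real) has_integral v) {0..1}"
    using uniform[OF assms] by (rule has_integral_eq[rotated]) auto
  then have "((\<lambda>_. 1 :: real) has_integral v) ?S"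
    by (subst (asm) has_integral_restrict) auto
  then have "emeasure lborel ?S = ennreal v"
    using assms by (subst (asm) has_integral_iff_emeasure_lborel) auto
  then show ?thesis
    using assms by (simp add: measure_def)
qed

lemma represents_M: "represents M C"
  unfolding represents_def
proof (intro conjI ballI)
  show "prob_space M"
    unfolding M_def by (rule prob_space.prob_space_distr[OF prob_space_unif graph_measurable])
  fix u v :: real assume uv: "u \<in> {0..1}" "v \<in> {0..1}"
  have "(\<lambda>x. (clamp01 x, f (clamp01 x))) -` ({0..u} \<times> {0..v}) \<inter> space unif =
      {x. clamp01 x \<le> u \<and> f (clamp01 x) \<le> v}"
    using range[OF clamp01_simps(1)] by auto
  then show "measure M ({0..u} \<times> {0..v}) = C u v"
    using uv unfolding M_def C_def
    by (subst measure_distr[OF graph_measurable rect_in_square_borel]) auto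
qed (simp add: M_def)

lemma copula_C: "copula C"
proof (rule represents_copula[OF represents_M])
  fix u :: real assume u: "u \<in> {0..1}"
  have "f x \<le> 1" if "x \<in> {0..1}" for x
    using range[OF that] by simp
  then have "{x \<in> {0..1}. x \<le> u \<and> f x \<le> 1} = {0..u}"
    using u unfolding set_eq_iff mem_Collect_eq atLeastAtMost_iff by (meson order_trans)
  then show "C u 1 = u"
    using u by (simp add: C_eq)
next
  fix v :: real assume v: "v \<in> {0..1}"
  have "{x \<in> {0..1}. x \<le> 1 \<and> f x \<le> v} = {x \<in> {0..1}. f x \<le> v}"
    by auto
  then show "C 1 v = v"
    unfolding C_eq using level_measure[OF v] by (simp only:)
qed

sublocale rep: represented_copula M C
  by (rule represented_copulaI[OF copula_C represents_M])

lemma has_integral_graph: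
  fixes g :: "real \<times> real \<Rightarrow> real"
  assumes g: "continuous_on unit_square g"
  shows "((\<lambda>x. g (x, f x)) has_integral rep.expectation g) {0..1}"
proof -
  have m: "g \<in> borel_measurable square_borel"
    by (rule borel_measurable_continuous_on_restrict[OF g])
  have "integrable unif (\<lambda>x. g (clamp01 x, f (clamp01 x)))"
    using rep.integrable_cont[OF g] unfolding M_def
    by (subst (asm) integrable_distr_eq[OF graph_measurable m])
  then have "((\<lambda>x. g (clamp01 x, f (clamp01 x))) has_integral (\<integral>x. g (clamp01 x, f (clamp01 x)) \<partial>unif)) {0..1}"
    by (rule has_integral_unif)
  then have "((\<lambda>x. g (x, f x)) has_integral (\<integral>x. g (clamp01 x, f (clamp01 x)) \<partial>unif)) {0..1}"
    by (rule has_integral_eq[rotated]) (simp add: clamp01_id)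
  then show ?thesis
    unfolding M_def by (subst integral_distr[OF graph_measurable m])
qed

text \<open>A pointwise lower bound along the graph is enough: \<open>attains_mix\<close> later
  fills in the values between extremes.\<close>

lemma attains_at_least:
  assumes A: "((\<lambda>x. min x (f x)) has_integral A) {0..1}"
    and B: "((\<lambda>x. max 0 (x + f x - 1)) has_integral B) {0..1}"
    and k: "(k has_integral K) {0..1}" "\<And>x. x \<in> {0..1} \<Longrightarrow> k x \<le> C x (f x)"
  shows "\<exists>T\<ge>K. attains A B T"
proof -
  have "continuous_on unit_square (\<lambda>p :: real \<times> real. min (fst p) (snd p))"
    "continuous_on unit_square (\<lambda>p :: real \<times> real. max 0 (fst p + snd p - 1))"
    by (intro continuous_intros)+
  from this[THEN has_integral_graph]
  have "rep.expectation (\<lambda>p. min (fst p) (snd p)) = A" "rep.expectation (\<lambda>p. max 0 (fst p + snd p - 1)) = B"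
    using A B by (auto dest: has_integral_unique)
  moreover have "K \<le> rep.T"
    using has_integral_graph[OF copula_continuous_on[OF copula_C]] k by (auto intro: has_integral_le)
  ultimately show ?thesis
    unfolding attains_def rep.integral_diagonal[symmetric] rep.integral_antidiagonal[symmetric]
    using represents_M copula_C by blast
qed

text \<open>The whole interval from \<open>a\<close> to \<open>x\<close> is counted by
  \<open>C x (f x)\<close>.\<close>

lemma C_lower_excedance:
  assumes "0 \<le> a" "a \<le> x" "x \<le> 1" "\<And>y. a \<le> y \<Longrightarrow> y \<le> x \<Longrightarrow> f y \<le> f x"
  shows "x - a \<le> C x (f x)"
proof -
  have "measure lborel {a..x} \<le> measure lborel {y \<in> {0..1}. y \<le> x \<and> f y \<le> f x}"
    by (intro measure_mono_fmeasurable fmeasurable_unit_subset level_sets) (use assms in auto)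
  then show ?thesis using assms by (simp add: C_eq)
qed

text \<open>The points with image in the interval from \<open>a\<close> to \<open>f x\<close> have
  total length \<open>f x - a\<close> because \<open>f\<close> preserves the uniform distribution,
  and all of them lie to the left of \<open>x\<close>.\<close>

lemma C_lower_deficiency:
  assumes x: "x \<in> {0..1}" and a: "a \<in> {0..1}" "a \<le> f x"
    and le: "\<And>y. y \<in> {0..1} \<Longrightarrow> a < f y \<Longrightarrow> f y \<le> f x \<Longrightarrow> y \<le> x"
  shows "f x - a \<le> C x (f x)"
proof -
  let ?L = "\<lambda>v. {y \<in> {0..1}. f y \<le> v}"
  have "f x - a = measure lborel (?L (f x)) - measure lborel (?L a)"
    using level_measure[of "f x"] level_measure[of a] range[OF x] a by (simp only:)
  also have "\<dots> = measure lborel (?L (f x) - ?L a)"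
    using a by (intro measurable_measure_Diff[symmetric] fmeasurable_unit_subset level_sets) (auto intro: level_sets)
  also have "\<dots> \<le> measure lborel {y \<in> {0..1}. y \<le> x \<and> f y \<le> f x}"
    by (intro measure_mono_fmeasurable fmeasurable_unit_subset level_sets sets.Diff) (use le in \<open>auto intro: level_sets\<close>)
  finally show ?thesis by (simp add: C_eq)
qed

end

subsection \<open>An interval exchange attaining the upper bound\<close>

text \<open>Peels off the leftmost piece; repeated application integrates a piecewise affine
  function as a right-nested sum.\<close>

lemma has_integral_affine_cons:
  fixes h :: "real \<Rightarrow> real"
  assumes "a \<le> b" "\<And>x. a < x \<Longrightarrow> x < b \<Longrightarrow> h x = m * x + c" and J: "(h has_integral J) {b..d}" "b \<le> d"
  shows "(h has_integral m * (b\<^sup>2 - a\<^sup>2) / 2 + c * (b - a) + J) {a..d}"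
  using assms by (intro has_integral_combine[OF \<open>a \<le> b\<close> \<open>b \<le> d\<close> has_integral_affine_piece[OF assms(1,2) refl] J(1)])

lemma has_integral_step_piece:
  fixes h :: "real \<Rightarrow> real"
  assumes "a \<le> c" "c \<le> b" "\<And>x. a < x \<Longrightarrow> x < c \<Longrightarrow> h x = p" "\<And>x. c < x \<Longrightarrow> x < b \<Longrightarrow> h x = q"
  shows "(h has_integral p * (c - a) + q * (b - c)) {a..b}"
  using assms by (intro has_integral_combine[OF assms(1,2)] has_integral_affine_piece[where m = 0]) auto

text \<open>The value is the length of the part of the image interval below \<open>v\<close>,
  written as a difference so that adjacent images telescope.\<close>

lemma has_integral_below_translate:
  fixes f :: "real \<Rightarrow> real"
  assumes "a \<le> b" and f: "\<And>x. a < x \<Longrightarrow> x < b \<Longrightarrow> f x = x + s"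
  shows "((\<lambda>x. if f x \<le> v then 1 else 0 :: real) has_integral (min (b + s) v - min (a + s) v)) {a..b}"
proof -
  define c where "c = max a (min b (v - s))"
  have "((\<lambda>x. if f x \<le> v then 1 else 0 :: real) has_integral 1 * (c - a) + 0 * (b - c)) {a..b}"
    by (rule has_integral_step_piece) (use \<open>a \<le> b\<close> f in \<open>auto simp: c_def max_def min_def split: if_splits\<close>)
  also have "1 * (c - a) + 0 * (b - c) = min (b + s) v - min (a + s) v"
    using \<open>a \<le> b\<close> by (auto simp: c_def max_def min_def)
  finally show ?thesis .
qed

lemma has_integral_below_reflect:
  fixes f :: "real \<Rightarrow> real"
  assumes "a \<le> b" and f: "\<And>x. a < x \<Longrightarrow> x < b \<Longrightarrow> f x = s - x"
  shows "((\<lambda>x. if f x \<le> v then 1 else 0 :: real) has_integral (min (s - a) v - min (s - b) v)) {a..b}"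
proof -
  define c where "c = max a (min b (s - v))"
  have "((\<lambda>x. if f x \<le> v then 1 else 0 :: real) has_integral 0 * (c - a) + 1 * (b - c)) {a..b}"
    by (rule has_integral_step_piece) (use \<open>a \<le> b\<close> f in \<open>auto simp: c_def max_def min_def split: if_splits\<close>)
  also have "0 * (c - a) + 1 * (b - c) = min (s - a) v - min (s - b) v"
    using \<open>a \<le> b\<close> by (auto simp: c_def max_def min_def)
  finally show ?thesis .
qed

text \<open>
  The middle part of \<open>[a, 1 - a]\<close> is a block of length \<open>4 D\<close> centred at \<open>1/2\<close>, on which \<open>f\<close> exchanges
  the central half with the two outer quarters so that excedances (\<open>f x \<ge> x\<close>) and deficiencies
  (\<open>f x \<le> x\<close>) both increase. The parameter \<open>P\<close> moves from two separate half-swaps at \<open>P = 0\<close> to a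
  single one at \<open>P = D\<close>. Monotonicity makes the copula equal to \<open>min x (f x) - a\<close> along the graph
  in \<open>[a, 1 - a]\<close>, the largest value possible there.
\<close>

locale exchange =
  fixes a D P :: real
  assumes params: "0 \<le> a" "0 \<le> P" "P \<le> D" "a + 2 * D \<le> 1 / 2"
begin

definition f :: "real \<Rightarrow> real" where
  "f x = (if x < a then 1 - x
     else if x < 1/2 - 2 * D then x
     else if x < 1/2 - D then x + (D + P)
     else if x < 1/2 - P then x - D
     else if x < 1/2 + D - P then x + (D + P)
     else if x < 1/2 + D + P then x - 2 * D
     else if x < 1/2 + 2 * D then x - D
     else if x < 1 - a then x
     else 1 - x)"

lemma f_pieces:
  "x < a \<Longrightarrow> f x = 1 - x"
  "a \<le> x \<Longrightarrow> x < 1/2 - 2 * D \<Longrightarrow> f x = x"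
  "1/2 - 2 * D \<le> x \<Longrightarrow> x < 1/2 - D \<Longrightarrow> f x = x + (D + P)"
  "1/2 - D \<le> x \<Longrightarrow> x < 1/2 - P \<Longrightarrow> f x = x - D"
  "1/2 - P \<le> x \<Longrightarrow> x < 1/2 + D - P \<Longrightarrow> f x = x + (D + P)"
  "1/2 + D - P \<le> x \<Longrightarrow> x < 1/2 + D + P \<Longrightarrow> f x = x - 2 * D"
  "1/2 + D + P \<le> x \<Longrightarrow> x < 1/2 + 2 * D \<Longrightarrow> f x = x - D"
  "1/2 + 2 * D \<le> x \<Longrightarrow> x < 1 - a \<Longrightarrow> f x = x"
  "1 - a \<le> x \<Longrightarrow> f x = 1 - x"
  unfolding f_def using params by simp_all

lemma f_cases:
  obtains "x < a" "f x = 1 - x"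
  | "a \<le> x" "x < 1/2 - 2 * D" "f x = x"
  | "1/2 - 2 * D \<le> x" "x < 1/2 - D" "f x = x + (D + P)"
  | "1/2 - D \<le> x" "x < 1/2 - P" "f x = x - D"
  | "1/2 - P \<le> x" "x < 1/2 + D - P" "f x = x + (D + P)"
  | "1/2 + D - P \<le> x" "x < 1/2 + D + P" "f x = x - 2 * D"
  | "1/2 + D + P \<le> x" "x < 1/2 + 2 * D" "f x = x - D"
  | "1/2 + 2 * D \<le> x" "x < 1 - a" "f x = x"
  | "1 - a \<le> x" "f x = 1 - x"
proof -
  consider "x < a"
    | "a \<le> x" "x < 1/2 - 2 * D"
    | "1/2 - 2 * D \<le> x" "x < 1/2 - D"
    | "1/2 - D \<le> x" "x < 1/2 - P"
    | "1/2 - P \<le> x" "x < 1/2 + D - P"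
    | "1/2 + D - P \<le> x" "x < 1/2 + D + P"
    | "1/2 + D + P \<le> x" "x < 1/2 + 2 * D"
    | "1/2 + 2 * D \<le> x" "x < 1 - a"
    | "1 - a \<le> x"
    by linarith
  then show ?thesis
  proof cases
    case 1
    then show ?thesis using that(1) f_pieces(1) by blast
  next
    case 2
    then show ?thesis using that(2) f_pieces(2) by blast
  next
    case 3
    then show ?thesis using that(3) f_pieces(3) by blast
  next
    case 4
    then show ?thesis using that(4) f_pieces(4) by blast
  next
    case 5
    then show ?thesis using that(5) f_pieces(5) by blast
  next
    case 6
    then show ?thesis using that(6) f_pieces(6) by blast
  next
    case 7
    then show ?thesis using that(7) f_pieces(7) by blast
  next
    case 8
    then show ?thesis using that(8) f_pieces(8) by blast
  next
    case 9
    then show ?thesis using that(9) f_pieces(9) by blast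
  qed
qed

lemma f_range: "x \<in> {0..1} \<Longrightarrow> f x \<in> {0..1}"
  using params by (cases x rule: f_cases) auto

lemma f_uniform:
  assumes v: "v \<in> {0..1}"
  shows "((\<lambda>x. if f x \<le> v then 1 else 0 :: real) has_integral v) {0..1}"
proof -
  let ?h = "\<lambda>x. if f x \<le> v then 1 else 0 :: real"
  have 1: "(?h has_integral (min (1 - 0) v - min (1 - a) v)) {0..a}"
    using params f_pieces by (intro has_integral_below_reflect) auto
  have 2: "(?h has_integral (min (1/2 - 2 * D + 0) v - min (a + 0) v)) {a..1/2 - 2 * D}"
    using params f_pieces by (intro has_integral_below_translate) auto
  have 3: "(?h has_integral (min (1/2 - D + (D + P)) v - min (1/2 - 2 * D + (D + P)) v)) {1/2 - 2 * D..1/2 - D}"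
    using params f_pieces by (intro has_integral_below_translate) auto
  have 4: "(?h has_integral (min (1/2 - P + - D) v - min (1/2 - D + - D) v)) {1/2 - D..1/2 - P}"
    using params f_pieces by (intro has_integral_below_translate) auto
  have 5: "(?h has_integral (min (1/2 + D - P + (D + P)) v - min (1/2 - P + (D + P)) v)) {1/2 - P..1/2 + D - P}"
    using params f_pieces by (intro has_integral_below_translate) auto
  have 6: "(?h has_integral (min (1/2 + D + P + - 2 * D) v - min (1/2 + D - P + - 2 * D) v)) {1/2 + D - P..1/2 + D + P}"
    using params f_pieces by (intro has_integral_below_translate) auto
  have 7: "(?h has_integral (min (1/2 + 2 * D + - D) v - min (1/2 + D + P + - D) v)) {1/2 + D + P..1/2 + 2 * D}"
    using params f_pieces by (intro has_integral_below_translate) auto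
  have 8: "(?h has_integral (min (1 - a + 0) v - min (1/2 + 2 * D + 0) v)) {1/2 + 2 * D..1 - a}"
    using params f_pieces by (intro has_integral_below_translate) auto
  have 9: "(?h has_integral (min (1 - (1 - a)) v - min (1 - 1) v)) {1 - a..1}"
    using params f_pieces by (intro has_integral_below_reflect) auto
  note c = has_integral_combine
  have "(?h has_integral
      ((min (1 - 0) v - min (1 - a) v) + ((min (1/2 - 2 * D + 0) v - min (a + 0) v) +
      ((min (1/2 - D + (D + P)) v - min (1/2 - 2 * D + (D + P)) v) +
      ((min (1/2 - P + - D) v - min (1/2 - D + - D) v) +
      ((min (1/2 + D - P + (D + P)) v - min (1/2 - P + (D + P)) v) +
      ((min (1/2 + D + P + - 2 * D) v - min (1/2 + D - P + - 2 * D) v) +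
      ((min (1/2 + 2 * D + - D) v - min (1/2 + D + P + - D) v) +
      ((min (1 - a + 0) v - min (1/2 + 2 * D + 0) v) +
       (min (1 - (1 - a)) v - min (1 - 1) v)))))))))) {0..1}"
    by (intro c[OF _ _ 1] c[OF _ _ 2] c[OF _ _ 3] c[OF _ _ 4] c[OF _ _ 5] c[OF _ _ 6] c[OF _ _ 7] c[OF _ _ 8] 9)
      (use params in auto)
  \<comment> \<open>The nine images tile the unit interval; once their endpoints are normalised, the
    sum telescopes to \<open>min 1 v - min 0 v\<close>.\<close>
  moreover have "1/2 - D + (D + P) = 1/2 + P" "1/2 - 2 * D + (D + P) = 1/2 - D + P"
    "1/2 - P + - D = 1/2 - D - P" "1/2 - D + - D = 1/2 - 2 * D"
    "1/2 + D - P + (D + P) = 1/2 + 2 * D" "1/2 - P + (D + P) = 1/2 + D"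
    "1/2 + D + P + - 2 * D = 1/2 - D + P" "1/2 + D - P + - 2 * D = 1/2 - D - P"
    "1/2 + 2 * D + - D = 1/2 + D" "1/2 + D + P + - D = 1/2 + P" "1 - (1 - a) = a"
    by simp_all
  moreover have "min 1 v = v" "min 0 v = 0"
    using v by auto
  ultimately show ?thesis
    by (simp add: algebra_simps)
qed

sublocale shuffle f
proof
  show "f \<in> borel_measurable borel"
    unfolding f_def by measurable
qed (fact f_range f_uniform)+

lemma has_integral_min:
  "((\<lambda>x. min x (f x)) has_integral 1/4 + (1/2 - a)\<^sup>2 - 2 * D * (D + P)) {0..1}" (is "(?h has_integral ?I) _")
proof -
  have "(?h has_integral
     1 * (a\<^sup>2 - 0\<^sup>2) / 2 + 0 * (a - 0) +
    (1 * ((1/2 - D)\<^sup>2 - a\<^sup>2) / 2 + 0 * (1/2 - D - a) +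
    (1 * ((1/2 - P)\<^sup>2 - (1/2 - D)\<^sup>2) / 2 + (- D) * (1/2 - P - (1/2 - D)) +
    (1 * ((1/2 + D - P)\<^sup>2 - (1/2 - P)\<^sup>2) / 2 + 0 * (1/2 + D - P - (1/2 - P)) +
    (1 * ((1/2 + D + P)\<^sup>2 - (1/2 + D - P)\<^sup>2) / 2 + (- 2 * D) * (1/2 + D + P - (1/2 + D - P)) +
    (1 * ((1/2 + 2 * D)\<^sup>2 - (1/2 + D + P)\<^sup>2) / 2 + (- D) * (1/2 + 2 * D - (1/2 + D + P)) +
    (1 * ((1 - a)\<^sup>2 - (1/2 + 2 * D)\<^sup>2) / 2 + 0 * (1 - a - (1/2 + 2 * D)) +
    ((-1) * (1\<^sup>2 - (1 - a)\<^sup>2) / 2 + 1 * (1 - (1 - a)))))))))) {0..1}"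
    using params
    by (intro has_integral_affine_cons has_integral_affine_piece[where m = "-1" and c = 1] refl)
      (simp_all add: min_def f_def)
  moreover have "1 * (a\<^sup>2 - 0\<^sup>2) / 2 + 0 * (a - 0) +
    (1 * ((1/2 - D)\<^sup>2 - a\<^sup>2) / 2 + 0 * (1/2 - D - a) +
    (1 * ((1/2 - P)\<^sup>2 - (1/2 - D)\<^sup>2) / 2 + (- D) * (1/2 - P - (1/2 - D)) +
    (1 * ((1/2 + D - P)\<^sup>2 - (1/2 - P)\<^sup>2) / 2 + 0 * (1/2 + D - P - (1/2 - P)) +
    (1 * ((1/2 + D + P)\<^sup>2 - (1/2 + D - P)\<^sup>2) / 2 + (- 2 * D) * (1/2 + D + P - (1/2 + D - P)) +
    (1 * ((1/2 + 2 * D)\<^sup>2 - (1/2 + D + P)\<^sup>2) / 2 + (- D) * (1/2 + 2 * D - (1/2 + D + P)) +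
    (1 * ((1 - a)\<^sup>2 - (1/2 + 2 * D)\<^sup>2) / 2 + 0 * (1 - a - (1/2 + 2 * D)) +
    ((-1) * (1\<^sup>2 - (1 - a)\<^sup>2) / 2 + 1 * (1 - (1 - a))))))))) = ?I"
    by (simp add: power2_eq_square field_simps)
  ultimately show ?thesis by (simp only:)
qed

lemma has_integral_max:
  "((\<lambda>x. max 0 (x + f x - 1)) has_integral (1/2 - a)\<^sup>2 - 2 * D * P) {0..1}" (is "(?h has_integral ?I) _")
proof -
  \<comment> \<open>The breakpoint \<open>1/2 + D\<close>, absent from \<open>f\<close>, is where
    \<open>x - 2 * D\<close> crosses \<open>1 - x\<close>. On the first translated piece,
    \<open>P \<le> D\<close> keeps the graph on or below the antidiagonal.\<close>
  have "(?h has_integral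
     0 * (a\<^sup>2 - 0\<^sup>2) / 2 + 0 * (a - 0) +
    (0 * ((1/2 - P)\<^sup>2 - a\<^sup>2) / 2 + 0 * (1/2 - P - a) +
    (2 * ((1/2 + D - P)\<^sup>2 - (1/2 - P)\<^sup>2) / 2 + (D + P - 1) * (1/2 + D - P - (1/2 - P)) +
    (0 * ((1/2 + D)\<^sup>2 - (1/2 + D - P)\<^sup>2) / 2 + 0 * (1/2 + D - (1/2 + D - P)) +
    (2 * ((1/2 + D + P)\<^sup>2 - (1/2 + D)\<^sup>2) / 2 + (- 2 * D - 1) * (1/2 + D + P - (1/2 + D)) +
    (2 * ((1/2 + 2 * D)\<^sup>2 - (1/2 + D + P)\<^sup>2) / 2 + (- D - 1) * (1/2 + 2 * D - (1/2 + D + P)) +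
    (2 * ((1 - a)\<^sup>2 - (1/2 + 2 * D)\<^sup>2) / 2 + (-1) * (1 - a - (1/2 + 2 * D)) +
    (0 * (1\<^sup>2 - (1 - a)\<^sup>2) / 2 + 0 * (1 - (1 - a)))))))))) {0..1}"
    using params
    by (intro has_integral_affine_cons has_integral_affine_piece[where m = 0 and c = 0] refl)
      (simp_all add: max_def f_def)
  moreover have "0 * (a\<^sup>2 - 0\<^sup>2) / 2 + 0 * (a - 0) +
    (0 * ((1/2 - P)\<^sup>2 - a\<^sup>2) / 2 + 0 * (1/2 - P - a) +
    (2 * ((1/2 + D - P)\<^sup>2 - (1/2 - P)\<^sup>2) / 2 + (D + P - 1) * (1/2 + D - P - (1/2 - P)) +
    (0 * ((1/2 + D)\<^sup>2 - (1/2 + D - P)\<^sup>2) / 2 + 0 * (1/2 + D - (1/2 + D - P)) +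
    (2 * ((1/2 + D + P)\<^sup>2 - (1/2 + D)\<^sup>2) / 2 + (- 2 * D - 1) * (1/2 + D + P - (1/2 + D)) +
    (2 * ((1/2 + 2 * D)\<^sup>2 - (1/2 + D + P)\<^sup>2) / 2 + (- D - 1) * (1/2 + 2 * D - (1/2 + D + P)) +
    (2 * ((1 - a)\<^sup>2 - (1/2 + 2 * D)\<^sup>2) / 2 + (-1) * (1 - a - (1/2 + 2 * D)) +
    (0 * (1\<^sup>2 - (1 - a)\<^sup>2) / 2 + 0 * (1 - (1 - a))))))))) = ?I"
    by (simp add: power2_eq_square field_simps)
  ultimately show ?thesis by (simp only:)
qed

text \<open>The integrand is the loss of \<open>C\<close> against \<open>min x (f x)\<close>: it is
  \<open>a\<close> on the middle part, and on the reflected ends it equals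
  \<open>min x (f x)\<close>.\<close>

lemma has_integral_frame:
  "((\<lambda>x. min (min x (1 - x)) a) has_integral a * (1 - a)) {0..1}" (is "(?h has_integral _) _")
proof -
  have "(?h has_integral
     1 * (a\<^sup>2 - 0\<^sup>2) / 2 + 0 * (a - 0) +
    (0 * ((1 - a)\<^sup>2 - a\<^sup>2) / 2 + a * (1 - a - a) +
    ((-1) * (1\<^sup>2 - (1 - a)\<^sup>2) / 2 + 1 * (1 - (1 - a))))) {0..1}"
    using params
    by (intro has_integral_affine_cons has_integral_affine_piece[where m = "-1" and c = 1] refl)
      (simp_all add: min_def)
  moreover have "1 * (a\<^sup>2 - 0\<^sup>2) / 2 + 0 * (a - 0) +
    (0 * ((1 - a)\<^sup>2 - a\<^sup>2) / 2 + a * (1 - a - a) +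
    ((-1) * (1\<^sup>2 - (1 - a)\<^sup>2) / 2 + 1 * (1 - (1 - a)))) = a * (1 - a)"
    by (simp add: power2_eq_square field_simps)
  ultimately show ?thesis by (simp only:)
qed

text \<open>If \<open>f y \<le> y\<close>, the claim follows from
  \<open>y \<le> x \<le> f x\<close>; otherwise both points are excedances, where \<open>f\<close>
  increases. The proof checks all pairs of pieces.\<close>

lemma excedance_mono:
  assumes "a \<le> y" "y \<le> x" "x < 1 - a" "x \<le> f x"
  shows "f y \<le> f x"
  by (cases x rule: f_cases; cases y rule: f_cases) (use assms params in linarith)+

text \<open>If \<open>y \<le> f y\<close>, the claim follows from
  \<open>f y \<le> f x \<le> x\<close>; otherwise both are deficiencies. The strict
  \<open>a < f y\<close> rules out the right end, including \<open>y = 1 - a\<close> with image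
  exactly \<open>a\<close>.\<close>

lemma deficiency_mono:
  assumes "a < f y" "f y \<le> f x" "f x \<le> x" "a \<le> x" "x < 1 - a"
  shows "y \<le> x"
  by (cases x rule: f_cases; cases y rule: f_cases) (use assms params in linarith)+

lemma C_lower:
  assumes x: "x \<in> {0..1}"
  shows "min x (f x) - min (min x (1 - x)) a \<le> C x (f x)"
proof -
  have nonneg: "0 \<le> C x (f x)"
    by (rule copula_nonneg[OF copula_C x f_range[OF x]])
  consider "x < a" | "1 - a \<le> x" | "a \<le> x" "x < 1 - a"
    by linarith
  then show ?thesis
  proof cases
    case 1
    then show ?thesis using nonneg params by (simp add: f_pieces min_def)
  next
    case 2
    then show ?thesis using nonneg params by (simp add: f_pieces min_def)
  next
    case 3
    then have fx: "a \<le> f x"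
      using params by (cases x rule: f_cases) linarith+
    have frame: "min (min x (1 - x)) a = a"
      using 3 by simp
    show ?thesis
    proof (cases "x \<le> f x")
      case True
      have "x - a \<le> C x (f x)"
        by (rule C_lower_excedance) (use 3 x params True excedance_mono in auto)
      then show ?thesis using True frame by simp
    next
      case False
      have "f x - a \<le> C x (f x)"
        by (rule C_lower_deficiency) (use 3 x params False fx deficiency_mono in auto)
      then show ?thesis using False frame by simp
    qed
  qed
qed

lemma attains_exchange:
  "\<exists>T \<ge> 1/4 + (1/2 - a)\<^sup>2 - 2 * D * (D + P) - a * (1 - a).
     attains (1/4 + (1/2 - a)\<^sup>2 - 2 * D * (D + P)) ((1/2 - a)\<^sup>2 - 2 * D * P) T"
  by (rule attains_at_least[OF has_integral_min has_integral_max
      has_integral_diff[OF has_integral_min has_integral_frame]]) (rule C_lower)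

end

section \<open>Filling the polyhedron\<close>

lemma attains_upper:
  assumes A: "1/4 \<le> A" and B: "B \<le> 1/4" "B \<le> A - 1/8" "A - 1/4 \<le> B"
  shows "\<exists>T \<ge> min A (2 * B). attains A B T"
proof -
  \<comment> \<open>In the exchange, \<open>A - B = 1/4 - 2 * D^2\<close> whatever \<open>a\<close>
    and \<open>P\<close> are, which determines \<open>D\<close>.\<close>
  define D where "D = sqrt ((1 - 4 * A + 4 * B) / 8)"
  have D2: "D\<^sup>2 = (1 - 4 * A + 4 * B) / 8" and D: "0 \<le> D"
    using B by (simp_all add: D_def)
  show ?thesis
  proof (cases "A \<le> 2 * B")
    case True
    \<comment> \<open>With \<open>a = 0\<close> nothing is lost and \<open>T\<close> reaches
      \<open>A\<close>; the equation for \<open>B\<close> gives \<open>P\<close>, and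
      \<open>A \<le> 2 * B\<close> amounts to \<open>P \<le> D\<close>. If \<open>D = 0\<close>,
      division by zero yields \<open>P = 0\<close>, consistent with \<open>B = 1/4\<close>.\<close>
    define P where "P = (1/4 - B) / (2 * D)"
    have DP: "2 * D * P = 1/4 - B"
    proof (cases "D = 0")
      case True
      then have "B = 1/4" using D2 B \<open>A \<le> 2 * B\<close> by simp
      then show ?thesis by (simp add: True)
    qed (simp add: P_def)
    have "0 \<le> P" using D B by (simp add: P_def)
    moreover have "P \<le> D"
    proof (cases "D = 0")
      case False
      have "2 * D * P \<le> 2 * D * D"
        using True DP D2 by (simp add: power2_eq_square)
      then show ?thesis using False D by (simp add: mult_le_cancel_left)
    qed (simp add: P_def)
    moreover have "D \<le> 1/4"
    proof (rule power2_le_imp_le)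
      show "D\<^sup>2 \<le> (1/4)\<^sup>2" using D2 B by (simp add: power2_eq_square)
    qed simp
    ultimately interpret exchange 0 D P
      by unfold_locales simp_all
    have "1/4 + (1/2 - 0)\<^sup>2 - 2 * D * (D + P) = A" "(1/2 - 0)\<^sup>2 - 2 * D * P = B"
      using DP D2 by (simp_all add: power2_eq_square algebra_simps)
    from attains_exchange[unfolded this] obtain T where "A - 0 * (1 - 0) \<le> T" "attains A B T"
      by blast
    then show ?thesis by (intro exI[of _ T]) auto
  next
    case False
    \<comment> \<open>Now \<open>P = D\<close>, and \<open>s = 1/2 - a\<close> solves
      \<open>B = s^2 - 2 * D^2\<close>. The case assumption gives \<open>s \<le> 1/2\<close>, and
      \<open>1/4 \<le> A\<close> makes the block of half-length \<open>2 * D\<close> fit.\<close>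
    define s where "s = sqrt (8 * B - 4 * A + 1) / 2"
    define a where "a = 1/2 - s"
    have s2: "s\<^sup>2 = (8 * B - 4 * A + 1) / 4" and s: "0 \<le> s"
      using A B by (simp_all add: s_def power_divide)
    have "s \<le> 1/2"
    proof (rule power2_le_imp_le)
      show "s\<^sup>2 \<le> (1/2)\<^sup>2" using s2 False by (simp add: power2_eq_square)
    qed simp
    moreover have "2 * D \<le> s"
    proof (rule power2_le_imp_le)
      show "(2 * D)\<^sup>2 \<le> s\<^sup>2" using s2 D2 A by (simp add: power_mult_distrib)
    qed (rule s)
    ultimately interpret exchange a D D
      using D by unfold_locales (simp_all add: a_def)
    have "1/4 + (1/2 - a)\<^sup>2 - 2 * D * (D + D) = A" "(1/2 - a)\<^sup>2 - 2 * D * D = B" "A - a * (1 - a) = 2 * B"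
      using s2 D2 by (simp_all add: a_def power2_eq_square algebra_simps)
    from attains_exchange[unfolded this] obtain T where "2 * B \<le> T" "attains A B T"
      by blast
    then show ?thesis by (intro exI[of _ T]) auto
  qed
qed

lemma attains_polyhedron:
  assumes A: "1/4 \<le> A" and B: "B \<le> 1/4" "B \<le> A - 1/8"
    and T: "2 * A - 1/2 \<le> T" "B \<le> T" "T \<le> A" "T \<le> 2 * B"
  shows "attains A B T"
proof -
  obtain T1 where T1: "min A (2 * B) \<le> T1" "attains A B T1"
    using attains_upper[of A B] A B T by auto
  \<comment> \<open>The reflected pair satisfies the same constraints. Reflecting back gives
    \<open>1/2 - T0 \<le> max B (2 * A - 1/2)\<close>, so the lower extreme is reached.\<close>
  obtain T0 where T0: "min (1/2 - B) (2 * (1/2 - A)) \<le> T0" "attains (1/2 - B) (1/2 - A) T0"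
    using attains_upper[of "1/2 - B" "1/2 - A"] A B T by auto
  have "attains A B (1/2 - T0)"
    using attains_reflect[OF T0(2)] by simp
  then show ?thesis
    by (rule attains_mix[OF _ T1(2)]) (use T T0 T1 in \<open>auto simp: min_def split: if_splits\<close>)
qed

theorem theorem4p7:
  "footrule_gamma_tau_region = footrule_gamma_tau_polyhedron"
proof (rule antisym[OF region_subset_polyhedron], rule subsetI)
  fix p assume p: "p \<in> footrule_gamma_tau_polyhedron"
  obtain \<phi> \<gamma> \<tau> where eq: "p = (\<phi>, \<gamma>, \<tau>)" by (cases p)
  define A B T where "A = (\<phi> + 2) / 6" and "B = (\<gamma> + 2) / 4 - A" and "T = (\<tau> + 1) / 4"
  have "attains A B T"
    by (rule attains_polyhedron)
      (use p in \<open>auto simp: eq footrule_gamma_tau_polyhedron_def A_def B_def T_def field_simps\<close>)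
  then obtain M C where C: "copula C" "represents M C" "integral {0..1} (\<lambda>t. C t t) = A"
     "integral {0..1} (\<lambda>t. C t (1 - t)) = B" "(\<integral>p. C (fst p) (snd p) \<partial>M) = T"
    unfolding attains_def by blast
  have "p = (spearman_footrule C, gini_gamma C, kendall_tau C)"
    unfolding eq spearman_footrule_def gini_gamma_def kendall_tau_def copula_measure_eqI[OF C(2)] C(3-5)
    by (simp add: A_def B_def T_def field_simps)
  then show "p \<in> footrule_gamma_tau_region"
    unfolding footrule_gamma_tau_region_def using C(1) by blast
qed

end
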